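(* Let $\Gamma$ be a graph and let $\mathcal{P}\Gamma$ be its graph-associahedron. Then $\mathcal{P}\Gamma$ is a simple, convex polytope whose face poset is isomorphic to the set of valid tubings of $\Gamma$, ordered such that $T \prec T'$ if $T$ is obtained from $T'$ by adding tubes.
   Context: Graphs have finitely many nodes. A *tube* of $\Gamma$ is a proper nonempty set of nodes of $\Gamma$ whose induced graph is a proper, connected subgraph of $\Gamma$. Two tubes $t_1,t_2$ are *nested* if $t_1\subset t_2$; they *intersect* if $t_1\cap t_2\neq\emptyset$ and $t_1\not\subset t_2$ and $t_2\not\subset t_1$; they are *adjacent* if $t_1\cap t_2=\emptyset$ and $t_1\cup t_2$ is a tube in $\Gamma$. Tubes are *compatible* if they do not intersect and they are not adjacent. A (valid) *tubing* $T$ of $\Gamma$ is a set of tubes of $\Gamma$ (possibly empty) such that every pair of tubes in $T$ is compatible; a *$k$-tubing* is a tubing with $k$ tubes. Graph-associahedron: if $\Gamma$ has $n$ nodes, let $\triangle_\Gamma$ be the $(n-1)$-simplex in which each facet (codimension $1$ face) corresponds to a particular node of $\Gamma$. Each proper subset of nodes of $\Gamma$ corresponds to a unique face of $\triangle_\Gamma$, defined by the intersection of the facets associated to those nodes; the empty set corresponds to $\triangle_\Gamma$ itself. The graph-associahedron $\mathcal{P}\Gamma$ is the polytope obtained from $\triangle_\Gamma$ by truncating the faces which correspond to $1$-tubings in increasing order of dimension. Here truncating a polytope $P$ at a face $f$ means intersecting $P$ with a closed halfspace $H^+$ such that a vertex of $P$ is in $H^+$ if and only if it is not in $f$, and no vertex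 of $P$ lies on the bounding hyperplane. The face poset is the set of nonempty faces, including the polytope itself, ordered by inclusion.
   Formalization: Disjoint tubes count as adjacent when their union induces a connected subgraph, even if it is all of Γ, and a valid tubing may not contain every connected component of Γ; with the literal definitions the claim fails (e.g. two nodes: 4 tubings, but a segment has 3 nonempty faces). *)

theory Defs
  imports "HOL-Analysis.Analysis" "Graph_Theory.Digraph_Component"
begin

text \<open>
  Undirected graphs are symmetric digraphs, as in the AFP entry \<open>Graph_Theory\<close>. Its constant
  \<open>connected\<close> shares its base name with topological connectedness and is therefore
  written with a qualifier.
\<close>

definition tube :: "('a, 'b) pre_digraph \<Rightarrow> 'a set \<Rightarrow> bool" where
  "tube G t \<longleftrightarrow> t \<noteq> {} \<and> t \<subset> verts G \<and> Digraph_Component.connected (G \<restriction> t)"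

definition tubes :: "('a, 'b) pre_digraph \<Rightarrow> 'a set set" where
  "tubes G = {t. tube G t}"

definition tubes_intersect :: "'a set \<Rightarrow> 'a set \<Rightarrow> bool" where
  "tubes_intersect t u \<longleftrightarrow> t \<inter> u \<noteq> {} \<and> \<not> t \<subseteq> u \<and> \<not> u \<subseteq> t"

text \<open>
  Adjacency asks that \<open>t \<union> u\<close> induce a connected subgraph; it does not ask that \<open>t \<union> u\<close> be a
  proper subset of the nodes. So two disjoint tubes that together exhaust a connected graph
  are adjacent. Otherwise, on the path with two nodes, the two one-node tubes would be
  compatible and the segment would have a fourth nonempty face.
\<close>

definition tubes_adjacent :: "('a, 'b) pre_digraph \<Rightarrow> 'a set \<Rightarrow> 'a set \<Rightarrow> bool" where
  "tubes_adjacent G t u \<longleftrightarrow> t \<inter> u = {} \<and> Digraph_Component.connected (G \<restriction> (t \<union> u))"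

definition tubes_compatible :: "('a, 'b) pre_digraph \<Rightarrow> 'a set \<Rightarrow> 'a set \<Rightarrow> bool" where
  "tubes_compatible G t u \<longleftrightarrow> \<not> tubes_intersect t u \<and> \<not> tubes_adjacent G t u"

text \<open>
  \<open>sccs_verts\<close> is the set of (node sets of) connected components, since \<open>G\<close> is symmetric. The last
  conjunct is the usual convention for disconnected graphs: a tubing does not contain all
  the components (the facets labelled by all the nodes have empty intersection). It holds
  automatically for connected \<open>G\<close>, where the only component is \<open>verts G\<close>, which is not a tube.
\<close>

definition tubing :: "('a, 'b) pre_digraph \<Rightarrow> 'a set set \<Rightarrow> bool" where
  "tubing G T \<longleftrightarrow> T \<subseteq> tubes G \<and> pairwise (tubes_compatible G) T \<and>
     \<not> pre_digraph.sccs_verts G \<subseteq> T"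

text \<open>
  The simplex has its vertices \<open>c i\<close> indexed by the nodes \<open>i \<in> V\<close>, and node \<open>i\<close> corresponds to the facet
  opposite to \<open>c i\<close>. Every bijection between nodes and facets arises in this way, and for a
  single node the facet is the empty set.
\<close>

definition simplex_facet :: "('a \<Rightarrow> 'c::euclidean_space) \<Rightarrow> 'a set \<Rightarrow> 'a \<Rightarrow> 'c set" where
  "simplex_facet c V i = convex hull (c ` (V - {i}))"

definition simplex_face :: "('a \<Rightarrow> 'c::euclidean_space) \<Rightarrow> 'a set \<Rightarrow> 'a set \<Rightarrow> 'c set" where
  "simplex_face c V S = convex hull (c ` V) \<inter> (\<Inter>i\<in>S. simplex_facet c V i)"

definition truncation :: "'c::euclidean_space set \<Rightarrow> 'c set \<Rightarrow> 'c set \<Rightarrow> bool" where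
  "truncation P f Q \<longleftrightarrow> f face_of P \<and>
     (\<exists>a b. a \<noteq> 0 \<and> Q = P \<inter> {x. a \<bullet> x \<le> b} \<and>
        (\<forall>v. v extreme_point_of P \<longrightarrow> (v \<in> {x. a \<bullet> x \<le> b} \<longleftrightarrow> v \<notin> f) \<and> a \<bullet> v \<noteq> b))"

text \<open>
  Successive truncation at the faces in a list of faces of the initial polytope. At each
  step, what is cut off is the part of the face that the earlier truncations have left.
\<close>

inductive truncations :: "'c::euclidean_space set \<Rightarrow> 'c set list \<Rightarrow> 'c set \<Rightarrow> bool" where
  Nil: "truncations P [] P"
| Cons: "truncation P (P \<inter> f) Q \<Longrightarrow> truncations Q fs R \<Longrightarrow> truncations P (f # fs) R"

text \<open>
  The construction leaves the simplex, the halfspaces and the order among faces of equal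
  dimension open. So \<open>graph_associahedron G P\<close> says that \<open>P\<close> results from some such choice.
\<close>

definition graph_associahedron :: "('a, 'b) pre_digraph \<Rightarrow> 'c::euclidean_space set \<Rightarrow> bool" where
  "graph_associahedron G P \<longleftrightarrow>
     (\<exists>c ts. inj_on c (verts G) \<and> \<not> affine_dependent (c ` verts G) \<and>
        distinct ts \<and> set ts = tubes G \<and>
        sorted (map (\<lambda>t. aff_dim (simplex_face c (verts G) t)) ts) \<and>
        truncations (convex hull (c ` verts G)) (map (simplex_face c (verts G)) ts) P)"

definition simple_polytope :: "'c::euclidean_space set \<Rightarrow> bool" where
  "simple_polytope P \<longleftrightarrow> polytope P \<and>
     (\<forall>v. v extreme_point_of P \<longrightarrow> int (card {F. F facet_of P \<and> v \<in> F}) = aff_dim P)"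

definition faces :: "'c::euclidean_space set \<Rightarrow> 'c set set" where
  "faces P = {F. F face_of P \<and> F \<noteq> {}}"

definition poset_isomorphic ::
  "'a set \<Rightarrow> ('a \<Rightarrow> 'a \<Rightarrow> bool) \<Rightarrow> 'b set \<Rightarrow> ('b \<Rightarrow> 'b \<Rightarrow> bool) \<Rightarrow> bool" where
  "poset_isomorphic A r B s \<longleftrightarrow>
     (\<exists>\<phi>. bij_betw \<phi> A B \<and> (\<forall>x\<in>A. \<forall>y\<in>A. r x y \<longleftrightarrow> s (\<phi> x) (\<phi> y)))"

text \<open>
  \<open>tubing_le T T'\<close>: \<open>T\<close> is obtained from \<open>T'\<close> by adding (possibly no) tubes.
\<close>

definition tubing_le :: "'a set set \<Rightarrow> 'a set set \<Rightarrow> bool" where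
  "tubing_le T T' \<longleftrightarrow> T' \<subseteq> T"

text \<open>
  Graph-associahedra exist in every Euclidean space that is large enough for the simplex.
\<close>

lemma truncation_exists:
  fixes P :: "'c::euclidean_space set"
  assumes "polytope P" "f face_of P"
  shows "\<exists>Q. truncation P f Q \<and> polytope Q"
proof -
  define E where "E = {v. v extreme_point_of P}"
  have finE: "finite E"
    using finite_polyhedron_extreme_points[OF polytope_imp_polyhedron[OF assms(1)]]
    by (simp add: E_def)
  have EP: "E \<subseteq> P" by (auto simp: E_def extreme_point_of_def)
  obtain e :: 'c where e: "e \<in> Basis" using nonempty_Basis by blast
  then have e0: "e \<noteq> 0" by auto
  have "\<exists>a b. a \<noteq> 0 \<and> (\<forall>v\<in>E. (a \<bullet> v \<le> b \<longleftrightarrow> v \<notin> f) \<and> a \<bullet> v \<noteq> b)"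
  proof -
    have "f exposed_face_of P"
      using exposed_face_of_polyhedron[OF polytope_imp_polyhedron[OF assms(1)]] assms(2) by blast
    then obtain a b where ab: "P \<subseteq> {x. a \<bullet> x \<le> b}" "f = P \<inter> {x. a \<bullet> x = b}"
      unfolding exposed_face_of_def by blast
    have sep: "\<exists>b'. \<forall>v\<in>E. (a' \<bullet> v \<le> b' \<longleftrightarrow> v \<notin> f) \<and> a' \<bullet> v \<noteq> b'"
      if *: "\<And>v w. v \<in> E \<Longrightarrow> w \<in> E \<Longrightarrow> v \<notin> f \<Longrightarrow> w \<in> f \<Longrightarrow> a' \<bullet> v < a' \<bullet> w" for a'
    proof -
      let ?L = "(\<lambda>v. a' \<bullet> v) ` (E - f)" and ?U = "(\<lambda>v. a' \<bullet> v) ` (E \<inter> f)"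
      have fin: "finite ?L" "finite ?U" using finE by auto
      have "\<exists>b'. (\<forall>x\<in>?L. x < b') \<and> (\<forall>y\<in>?U. b' < y)"
      proof (cases "?L = {}")
        case True
        show ?thesis
        proof (cases "?U = {}")
          case U: False
          have "\<forall>y\<in>?U. Min ?U - 1 < y"
          proof
            fix y assume "y \<in> ?U"
            then have "Min ?U \<le> y" by (rule Min_le[OF fin(2)])
            then show "Min ?U - 1 < y" by linarith
          qed
          with True show ?thesis by blast
        qed (use True in blast)
      next
        case L: False
        have Lm: "\<forall>x\<in>?L. x \<le> Max ?L" using fin by auto
        show ?thesis
        proof (cases "?U = {}")
          case True
          have "\<forall>x\<in>?L. x < Max ?L + 1" using Lm by force
          with True show ?thesis by blast
        next
          case U: False
          have "Max ?L \<in> ?L" "Min ?U \<in> ?U" using L U fin Max_in Min_in by blast+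
          then have "Max ?L < Min ?U" using * by auto
          then obtain m where m: "Max ?L < m" "m < Min ?U" using dense by blast
          have "\<forall>x\<in>?L. x < m" using Lm m by (meson le_less_trans)
          moreover have "\<forall>y\<in>?U. m < y" using m fin by (meson Min_le less_le_trans)
          ultimately show ?thesis by blast
        qed
      qed
      then obtain b' where b': "\<forall>x\<in>?L. x < b'" "\<forall>y\<in>?U. b' < y" by blast
      have "\<forall>v\<in>E. (a' \<bullet> v \<le> b' \<longleftrightarrow> v \<notin> f) \<and> a' \<bullet> v \<noteq> b'"
      proof
        fix v assume "v \<in> E"
        then show "(a' \<bullet> v \<le> b' \<longleftrightarrow> v \<notin> f) \<and> a' \<bullet> v \<noteq> b'"
          using b' by (cases "v \<in> f") force+
      qed
      then show ?thesis by blast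
    qed
    show ?thesis
    proof (cases "a = 0")
      case True
      then have "f = P \<or> f = {}" using ab by auto
      then have "\<exists>b'. \<forall>v\<in>E. (e \<bullet> v \<le> b' \<longleftrightarrow> v \<notin> f) \<and> e \<bullet> v \<noteq> b'"
        using EP by (intro sep) auto
      with e0 show ?thesis by blast
    next
      case False
      have "\<exists>b'. \<forall>v\<in>E. (a \<bullet> v \<le> b' \<longleftrightarrow> v \<notin> f) \<and> a \<bullet> v \<noteq> b'"
        using ab EP by (intro sep) force
      with False show ?thesis by blast
    qed
  qed
  then obtain a b where "a \<noteq> 0" "\<forall>v\<in>E. (a \<bullet> v \<le> b \<longleftrightarrow> v \<notin> f) \<and> a \<bullet> v \<noteq> b" by blast
  then have "truncation P f (P \<inter> {x. a \<bullet> x \<le> b})"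
    using assms(2) unfolding truncation_def E_def by blast
  moreover have "polytope (P \<inter> {x. a \<bullet> x \<le> b})"
    using assms(1) polytope_Int_polyhedron polyhedron_halfspace_le by blast
  ultimately show ?thesis by blast
qed

lemma truncation_subset: "truncation P f Q \<Longrightarrow> Q \<subseteq> P"
  by (auto simp: truncation_def)

lemma truncations_exist:
  fixes P :: "'c::euclidean_space set"
  assumes "polytope P" "P \<subseteq> S" "\<forall>f\<in>set fs. f face_of S"
  shows "\<exists>R. truncations P fs R"
  using assms
proof (induction fs arbitrary: P)
  case Nil
  then show ?case using truncations.Nil by blast
next
  case (Cons f fs)
  have "P \<inter> f face_of P \<inter> S"
    using Cons.prems by (intro face_of_Int_Int face_of_refl) (auto simp: polytope_imp_convex)
  then have "P \<inter> f face_of P" using Cons.prems(2) by (simp add: Int_absorb2)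
  then obtain Q where Q: "truncation P (P \<inter> f) Q" "polytope Q"
    using truncation_exists Cons.prems(1) by blast
  have "Q \<subseteq> S" using truncation_subset[OF Q(1)] Cons.prems(2) by blast
  then obtain R where "truncations Q fs R" using Cons.IH[OF Q(2)] Cons.prems(3) by auto
  then show ?case using Q(1) truncations.Cons by blast
qed

lemma simplex_face_face_of:
  assumes "\<not> affine_dependent (c ` V)" "inj_on c V" "S \<subseteq> V"
  shows "simplex_face c V S face_of convex hull (c ` V)"
proof -
  have *: "simplex_facet c V i face_of convex hull (c ` V)" for i
    unfolding simplex_facet_def
    by (simp add: face_of_convex_hull_affine_independent[OF assms(1)])
       (metis Diff_subset image_mono)
  show ?thesis
  proof (cases "S = {}")
    case True
    then show ?thesis by (simp add: simplex_face_def face_of_refl convex_convex_hull)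
  next
    case False
    then have "(\<Inter>i\<in>S. simplex_facet c V i) face_of convex hull (c ` V)"
      by (intro face_of_Inter) (use * in auto)
    then show ?thesis
      unfolding simplex_face_def by (simp add: face_of_Int face_of_refl convex_convex_hull)
  qed
qed

lemma graph_associahedron_exists:
  fixes G :: "('a, 'b) pre_digraph"
  assumes "finite (verts G)" "card (verts G) \<le> DIM('c::euclidean_space) + 1"
  shows "\<exists>P :: 'c set. graph_associahedron G P"
proof -
  obtain B :: "'c set" where B: "\<not> affine_dependent B" "affine hull B = (UNIV :: 'c set)"
    using affine_basis_exists[of "UNIV :: 'c set"] by auto
  have finB: "finite B" using B(1) by (rule aff_independent_finite)
  have "int (card B) = aff_dim (affine hull B) + 1"
    using aff_dim_affine_independent[OF B(1)] by (simp add: aff_dim_affine_hull)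
  then have "card B = DIM('c) + 1" using B(2) by simp
  then obtain c where c: "inj_on c (verts G)" "c ` verts G \<subseteq> B"
    using card_le_inj[OF assms(1) finB] assms(2) by auto
  have ind: "\<not> affine_dependent (c ` verts G)"
    using affine_independent_subset B(1) c(2) by blast
  have "finite (tubes G)"
    by (rule finite_subset[of _ "Pow (verts G)"]) (auto simp: tubes_def tube_def assms(1))
  then obtain us where us: "set us = tubes G" "distinct us"
    using finite_distinct_list by blast
  define ts where "ts = sort_key (\<lambda>t. aff_dim (simplex_face c (verts G) t)) us"
  have "\<forall>f \<in> set (map (simplex_face c (verts G)) ts). f face_of convex hull (c ` verts G)"
    using us(1) simplex_face_face_of[OF ind c(1)] by (auto simp: ts_def tubes_def tube_def)
  moreover have "polytope (convex hull (c ` verts G))"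
    using assms(1) by (simp add: polytope_convex_hull)
  ultimately obtain P where
    "truncations (convex hull (c ` verts G)) (map (simplex_face c (verts G)) ts) P"
    using truncations_exist by blast
  then have "graph_associahedron G P"
    unfolding graph_associahedron_def using c(1) ind us
    by (intro exI[of _ c] exI[of _ ts]) (simp add: ts_def)
  then show ?thesis by blast
qed

end

theory Submission
  imports Defs
begin

text \<open>
  Label the facets of the simplex by the one-node sets and each new facet by the tube that is cut
  off. Every face of a simple polytope is the intersection of a unique set of facets, so the face
  poset is read off from the simplicial complex of label sets whose facets meet. A truncation acts
  on this complex as a stellar subdivision, whatever halfspace is chosen, because the halfspace is
  only constrained through the vertices. Larger tubes are cut off first; hence at each stage the
  labels are closed under unions of intersecting sets (up to the whole node set), and the complex
  consists of the nested sets of labels. Once all tubes are labels, nested sets are tubings.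
\<close>

section \<open>Nested sets and stellar subdivision\<close>

text \<open>The halfspaces are free, so \<open>P\<close> has no explicit inequalities and the
  induction can carry only combinatorial data, collected in \<open>simple_labelling\<close>. Its
  dimension clause encodes simplicity: each label lowers the dimension by one, so a face determines
  its labels.

  The vertex condition on a halfspace suffices because every face is the hull of its vertices.
  Nonempty faces inside the truncated face disappear, those disjoint from it stay uncut, and the
  hyperplane splits the others. For a label set \<open>A\<close> these cases read
  \<open>S \<subseteq> A\<close>, \<open>A \<union> S \<notin> K\<close>, and neither of the two.

  The construction names faces of the initial simplex, and each of them has to be recognised in the
  current polytope. This works because one-node tubes come last: until then the facets of the
  simplex keep their labels and their sets.

  The condition \<open>\<Union>N \<noteq> V\<close> records that the facets of all the nodes have no
  common point. It survives every subdivision and ends up as the exclusion of tubings that contain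
  all components.\<close>

text \<open>
  For unions of at least two incomparable members the last condition says that they are not in
  \<open>B\<close>, which is the usual definition. Passing to all subfamilies avoids antichains.
\<close>

definition nested :: "'a set \<Rightarrow> 'a set set \<Rightarrow> 'a set set set" where
  "nested V B = {N. N \<subseteq> B \<and> \<Union>N \<noteq> V \<and> (\<forall>A\<subseteq>N. \<Union>A \<in> B \<longrightarrow> \<Union>A \<in> A)}"

text \<open>
  The case \<open>S = {n}\<close> occurs as well: truncating at a facet reuses its label.
\<close>

definition stellar :: "'l set \<Rightarrow> 'l \<Rightarrow> 'l set set \<Rightarrow> 'l set set" where
  "stellar S n K = {A \<in> K. n \<notin> A \<and> \<not> S \<subseteq> A} \<union>
     insert n ` {A \<in> K. n \<notin> A \<and> \<not> S \<subseteq> A \<and> A \<union> S \<in> K}"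

text \<open>Faces without \<open>n\<close> survive, and a face \<open>A\<close> that contains
  \<open>n\<close> is deleted but returns as the cone over \<open>A - {n}\<close>. So cutting off a
  facet changes nothing combinatorially.\<close>

lemma stellar_singleton:
  assumes "\<And>A B. A \<in> K \<Longrightarrow> B \<subseteq> A \<Longrightarrow> B \<in> K"
  shows "stellar {n} n K = K" (is "stellar ?S n K = K")
proof
  show "stellar ?S n K \<subseteq> K" using assms unfolding stellar_def by auto
  show "K \<subseteq> stellar ?S n K"
  proof
    fix A assume A: "A \<in> K"
    show "A \<in> stellar ?S n K"
    proof (cases "n \<in> A")
      case True
      then have "A = insert n (A - {n})" "(A - {n}) \<union> ?S = A" "A - {n} \<in> K"
        using A assms(1) by auto
      then have "A - {n} \<in> {A \<in> K. n \<notin> A \<and> \<not> ?S \<subseteq> A \<and> A \<union> ?S \<in> K}"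
        using A by simp
      then show ?thesis using \<open>A = _\<close> unfolding stellar_def by (intro UnI2 image_eqI)
    qed (use A in \<open>auto simp: stellar_def\<close>)
  qed
qed

lemma nestedI:
  assumes "N \<subseteq> B" "\<Union>N \<noteq> V" "\<And>A. A \<subseteq> N \<Longrightarrow> \<Union>A \<in> B \<Longrightarrow> \<Union>A \<in> A"
  shows "N \<in> nested V B"
  using assms by (simp add: nested_def)

lemma nestedD:
  assumes "N \<in> nested V B"
  shows "N \<subseteq> B" "\<Union>N \<noteq> V" "A \<subseteq> N \<Longrightarrow> \<Union>A \<in> B \<Longrightarrow> \<Union>A \<in> A"
  using assms by (simp_all add: nested_def)

lemma nested_mono:
  assumes N: "N \<in> nested V B" and "\<Union>N \<subseteq> V" "M \<subseteq> N"
  shows "M \<in> nested V B"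
proof (rule nestedI)
  show "M \<subseteq> B" using nestedD(1)[OF N] assms(3) by blast
  show "\<Union>M \<noteq> V" using nestedD(2)[OF N] assms(2,3) by blast
  fix A assume "A \<subseteq> M" "\<Union>A \<in> B"
  then show "\<Union>A \<in> A" using nestedD(3)[OF N] assms(3) by (meson subset_trans)
qed

text \<open>The families \<open>S\<close> and \<open>{t}\<close> have the same union, so one can be
  traded for the other inside a family. The hypotheses \<open>small\<close> and \<open>un\<close>
  are what cutting off larger tubes first provides.\<close>

lemma nested_insert:
  fixes V t :: "'a set" and B :: "'a set set"
  defines "S \<equiv> (\<lambda>i. {i}) ` t"
  assumes t: "t \<noteq> {}" "t \<subset> V" "t \<notin> B"
    and B: "B \<subseteq> Pow V" "{} \<notin> B" "S \<subseteq> B"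
    and small: "\<And>u. u \<in> B \<Longrightarrow> u \<subseteq> t \<Longrightarrow> \<exists>i. u = {i}"
    and un: "\<And>u. u \<in> B \<Longrightarrow> u \<inter> t \<noteq> {} \<Longrightarrow> u \<subseteq> t \<or> u \<union> t = V \<or> u \<union> t \<in> B"
  shows "S \<in> nested V B" "nested V (insert t B) = stellar S t (nested V B)"
proof -
  have US: "\<Union>S = t" by (auto simp: S_def)
  show "S \<in> nested V B"
    proof (intro nestedI)
    fix A assume A: "A \<subseteq> S" "\<Union>A \<in> B"
    then have "\<Union>A \<subseteq> t" using US by blast
    then obtain i where i: "\<Union>A = {i}" using small[OF A(2)] by blast
    then obtain a where "a \<in> A" "i \<in> a" by (metis UnionE insertI1)
    then have "a = {i}" using i A(1) S_def by auto
    then show "\<Union>A \<in> A" using i \<open>a \<in> A\<close> by simp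
  qed (use t B US in auto)
  have tS: "t \<notin> S" using t(3) B(3) by blast
  have sub: "N \<subseteq> B \<Longrightarrow> \<Union>N \<subseteq> V" for N using B(1) by blast
  \<comment> \<open>By \<open>small\<close> all members of \<open>A\<close> are one-node sets, so
    covering \<open>t\<close> takes every one of them.\<close>
  have inS: "A = S" if A: "A \<subseteq> B" "\<Union>A = t" for A
  proof -
    have *: "\<exists>i. u = {i}" if "u \<in> A" for u using that A small by blast
    show ?thesis
    proof
      show "A \<subseteq> S"
      proof
        fix u assume u: "u \<in> A"
        then obtain i where "u = {i}" using * by blast
        moreover have "u \<subseteq> t" using u A(2) by blast
        ultimately show "u \<in> S" by (simp add: S_def)
      qed
      show "S \<subseteq> A"
      proof
        fix u assume "u \<in> S"
        then obtain i where i: "u = {i}" "i \<in> t" by (auto simp: S_def)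
        then obtain w where w: "w \<in> A" "i \<in> w" using A(2) by blast
        then have "w = {i}" using * by fastforce
        then show "u \<in> A" using i w by simp
      qed
    qed
  qed
  \<comment> \<open>The new label adds one way to fail: a subfamily with union \<open>t\<close>,
    which can only be \<open>S\<close>.\<close>
  have old: "N \<in> nested V (insert t B) \<longleftrightarrow> N \<in> nested V B \<and> \<not> S \<subseteq> N" if tN: "t \<notin> N" for N
  proof
    assume N: "N \<in> nested V (insert t B)"
    have "\<not> S \<subseteq> N"
    proof
      assume "S \<subseteq> N"
      then have "\<Union>S \<in> S" using nestedD(3)[OF N, of S] US by simp
      then show False using US tS by simp
    qed
    moreover have "N \<in> nested V B"
      using nestedD[OF N] tN by (intro nestedI) blast+
    ultimately show "N \<in> nested V B \<and> \<not> S \<subseteq> N" by blast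
  next
    assume N: "N \<in> nested V B \<and> \<not> S \<subseteq> N"
    show "N \<in> nested V (insert t B)"
      proof (intro nestedI)
      fix A assume A: "A \<subseteq> N" "\<Union>A \<in> insert t B"
      show "\<Union>A \<in> A"
      proof (cases "\<Union>A = t")
        case True
        moreover have "A \<subseteq> B" using A(1) N nestedD(1) by blast
        ultimately show ?thesis using inS[of A] A(1) N by blast
      next
        case False
        then show ?thesis using A N nestedD(3) by blast
      qed
    qed (use N nestedD(1,2) in \<open>blast+\<close>)
  qed
  \<comment> \<open>\<open>insert t A\<close> and \<open>A \<union> S\<close> have the same union,
    so the condition on \<open>V\<close> carries over; the condition on subfamilies is transferred
    by trading in both directions.\<close>
  have new: "insert t A \<in> nested V (insert t B) \<longleftrightarrow>
      A \<in> nested V B \<and> \<not> S \<subseteq> A \<and> A \<union> S \<in> nested V B" if tA: "t \<notin> A" for A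
  proof
    assume N: "insert t A \<in> nested V (insert t B)"
    then have AB: "A \<subseteq> B" using tA nestedD(1) by blast
    have "\<Union>(insert t A) \<subseteq> V" using sub[OF AB] t(2) by auto
    then have "A \<in> nested V (insert t B)" using nested_mono[OF N] by blast
    then have A: "A \<in> nested V B" "\<not> S \<subseteq> A" using old tA by blast+
    have "A \<union> S \<in> nested V B"
      proof (intro nestedI)
      show "A \<union> S \<subseteq> B" using AB B(3) by blast
      have "\<Union>(A \<union> S) = \<Union>(insert t A)" using US by blast
      then show "\<Union>(A \<union> S) \<noteq> V" using nestedD(2)[OF N] by simp
      fix C assume C: "C \<subseteq> A \<union> S" "\<Union>C \<in> B"
      show "\<Union>C \<in> C"
      proof (cases "C \<subseteq> A")
        case True
        then show ?thesis using C A nestedD(3) by blast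
      next
        case False
        then obtain i where i: "{i} \<in> C" "i \<in> t" using C by (auto simp: S_def)
        show ?thesis
        proof (cases "\<Union>C \<subseteq> t")
          case True
          then obtain j where "\<Union>C = {j}" using small[OF C(2)] by blast
          moreover have "i \<in> \<Union>C" using i by blast
          ultimately show ?thesis using i by auto
        next
          case False
          \<comment> \<open>trade the members of \<open>C\<close> inside \<open>t\<close>, all of them one-node sets, for \<open>t\<close> itself\<close>
          define D where "D = insert t {c \<in> C. \<not> c \<subseteq> t}"
          have UD: "\<Union>D = \<Union>C \<union> t" by (auto simp: D_def)
          have DA: "D \<subseteq> insert t A" using C(1) by (auto simp: D_def S_def)
          have "\<Union>C \<inter> t \<noteq> {}" using i by blast
          then have "\<Union>D = V \<or> \<Union>D \<in> B" using un[OF C(2)] False UD by auto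
          moreover have "\<Union>D \<noteq> V"
          proof
            assume "\<Union>D = V"
            then have "\<Union>(insert t A) = V" using DA \<open>\<Union>(insert t A) \<subseteq> V\<close> by blast
            then show False using nestedD(2)[OF N] by simp
          qed
          ultimately have "\<Union>D \<in> insert t B" by blast
          then have "\<Union>D \<in> D" using nestedD(3)[OF N DA] by blast
          moreover have "\<Union>D \<noteq> t" using UD False by blast
          ultimately have "\<Union>D \<in> C" by (auto simp: D_def)
          \<comment> \<open>Being a member of \<open>C\<close>, the set \<open>\<Union>D\<close>
            lies inside \<open>\<Union>C\<close>; the other inclusion is \<open>UD\<close>.\<close>
          moreover have "\<Union>D = \<Union>C" using UD \<open>\<Union>D \<in> C\<close> by blast
          ultimately show ?thesis by simp
        qed
      qed
    qed
    then show "A \<in> nested V B \<and> \<not> S \<subseteq> A \<and> A \<union> S \<in> nested V B" using A by blast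
  next
    assume A: "A \<in> nested V B \<and> \<not> S \<subseteq> A \<and> A \<union> S \<in> nested V B"
    show "insert t A \<in> nested V (insert t B)"
      proof (intro nestedI)
      show "insert t A \<subseteq> insert t B" using A nestedD(1) by blast
      have "\<Union>(A \<union> S) = \<Union>(insert t A)" using US by blast
      then show "\<Union>(insert t A) \<noteq> V" using A nestedD(2) by metis
      fix C assume C: "C \<subseteq> insert t A" "\<Union>C \<in> insert t B"
      show "\<Union>C \<in> C"
      proof (cases "t \<in> C")
        case False
        then have "C \<subseteq> A" using C by blast
        moreover have "A \<in> nested V (insert t B)" using A old tA by blast
        ultimately show ?thesis using C(2) by (simp add: nestedD(3))
      next
        case True
        show ?thesis
        proof (cases "\<Union>C = t")
          case False
          then have CB: "\<Union>C \<in> B" using C by blast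
          \<comment> \<open>The opposite trade: \<open>t\<close> is replaced by its one-node
            subsets. Nestedness then yields a member of \<open>D\<close>, and it is no member of
            \<open>S\<close> because \<open>\<Union>C\<close> is strictly larger than
            \<open>t\<close>.\<close>
          define D where "D = C - {t} \<union> S"
          have UD: "\<Union>D = \<Union>C" using True US by (auto simp: D_def)
          have "D \<subseteq> A \<union> S" using C by (auto simp: D_def)
          then have "\<Union>C \<in> D" using nestedD(3)[of "A \<union> S" V B D] A CB UD by simp
          moreover have "\<Union>C \<notin> S"
          proof
            assume "\<Union>C \<in> S"
            then have "\<Union>C \<subseteq> t" using US Union_upper by metis
            then show False using True False by blast
          qed
          ultimately show ?thesis unfolding D_def by blast
        qed (use True in simp)
      qed
    qed
  qed
  show "nested V (insert t B) = stellar S t (nested V B)"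
  proof (intro set_eqI)
    fix N
    show "N \<in> nested V (insert t B) \<longleftrightarrow> N \<in> stellar S t (nested V B)"
    proof (cases "t \<in> N")
      case True
      define A where "A = N - {t}"
      have A: "N = insert t A" "t \<notin> A" using True by (auto simp: A_def)
      have "N \<in> stellar S t (nested V B) \<longleftrightarrow>
          A \<in> nested V B \<and> \<not> S \<subseteq> A \<and> A \<union> S \<in> nested V B"
        unfolding stellar_def A(1) using A(2) by (simp add: image_iff insert_ident)
      then show ?thesis using new[OF A(2)] A(1) by simp
    next
      case False
      then have "N \<in> stellar S t (nested V B) \<longleftrightarrow> N \<in> nested V B \<and> \<not> S \<subseteq> N"
        unfolding stellar_def by auto
      then show ?thesis using old[OF False] by simp
    qed
  qed
qed

section \<open>Connected sets of nodes\<close>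

abbreviation gconn :: "('a, 'b) pre_digraph \<Rightarrow> 'a set \<Rightarrow> bool" where
  "gconn G t \<equiv> Digraph_Component.connected (G \<restriction> t)"

text \<open>Later arguments only split a set in two, so connectedness is best used through arcs
  leaving a part, without paths in induced subgraphs. One direction follows a path out of
  \<open>A\<close>; the other applies the cut to the set reachable from \<open>u\<close>.\<close>

lemma connected_induce_iff_cut:
  assumes "sym_digraph G"
  shows "gconn G t \<longleftrightarrow> t \<noteq> {} \<and>
    (\<forall>A. A \<noteq> {} \<longrightarrow> A \<subset> t \<longrightarrow> (\<exists>x\<in>A. \<exists>y\<in>t - A. x \<rightarrow>\<^bsub>G\<^esub> y))"
proof -
  interpret sym_digraph G by fact
  let ?r = "(arcs_ends (G \<restriction> t))\<^sup>s"
  \<comment> \<open>As \<open>G\<close> is symmetric, the symmetric closure adds no arcs.\<close>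
  have r: "(x, y) \<in> ?r \<longleftrightarrow> x \<in> t \<and> y \<in> t \<and> x \<rightarrow>\<^bsub>G\<^esub> y" for x y
    using graph_symmetric unfolding symcl_def arcs_ends_conv
    by (fastforce simp: arcs_ends_conv)
  show ?thesis
  proof (cases "t = {}")
    case False
    have "(\<forall>u\<in>t. \<forall>v\<in>t. (u, v) \<in> rtrancl_on t ?r) \<longleftrightarrow>
       (\<forall>A. A \<noteq> {} \<longrightarrow> A \<subset> t \<longrightarrow> (\<exists>x\<in>A. \<exists>y\<in>t - A. x \<rightarrow>\<^bsub>G\<^esub> y))" (is "?L \<longleftrightarrow> ?R")
    proof (intro iffI allI impI ballI)
      fix A assume L: ?L and A: "A \<noteq> {}" "A \<subset> t"
      then obtain u v where uv: "u \<in> A" "v \<in> t - A" "u \<in> t" by blast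
      show "\<exists>x\<in>A. \<exists>y\<in>t - A. x \<rightarrow>\<^bsub>G\<^esub> y"
      proof (rule ccontr)
        assume no: "\<not> ?thesis"
        have "(u, v) \<in> rtrancl_on t ?r" using L uv by blast
        then have "v \<in> A"
          by (induction rule: rtrancl_on_induct) (use uv no r in auto)
        then show False using uv by blast
      qed
    next
      fix u v assume R: ?R and uv: "u \<in> t" "v \<in> t"
      define A where "A = {w. (u, w) \<in> rtrancl_on t ?r}"
      have At: "A \<subseteq> t" by (auto simp: A_def dest: in_rtrancl_on_in_F)
      have "u \<in> A" using uv by (auto simp: A_def)
      have "A = t"
      proof (rule ccontr)
        assume "A \<noteq> t"
        then obtain x y where "x \<in> A" "y \<in> t - A" "x \<rightarrow>\<^bsub>G\<^esub> y"
          using R At \<open>u \<in> A\<close> by (metis empty_iff psubsetI)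
        moreover then have "(x, y) \<in> ?r" using r At by auto
        ultimately show False
          by (auto simp: A_def intro: rtrancl_on_into_rtrancl_on)
      qed
      then show "(u, v) \<in> rtrancl_on t ?r" using uv A_def by blast
    qed
    then show ?thesis using False by (simp add: connected_conv)
  qed (simp add: connected_conv)
qed

context sym_digraph
begin

lemmas conn_cut = connected_induce_iff_cut[OF sym_digraph_axioms]

lemma connected_cutE:
  assumes "gconn G t" "A \<noteq> {}" "A \<subset> t"
  obtains x y where "x \<in> A" "y \<in> t - A" "x \<rightarrow>\<^bsub>G\<^esub> y"
  using assms unfolding conn_cut by blast

lemma connected_singleton: "gconn G {i}"
  unfolding conn_cut by auto

text \<open>A part that splits neither \<open>t\<close> nor \<open>u\<close> contains or avoids each
  of them. As they meet, it contains both or avoids both, so it is not a proper nonempty part of the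
  union.\<close>

lemma connected_Un:
  assumes "gconn G t" "gconn G u" "t \<inter> u \<noteq> {}"
  shows "gconn G (t \<union> u)"
  unfolding conn_cut
proof (intro conjI allI impI)
  show "t \<union> u \<noteq> {}" using assms by blast
  fix A assume A: "A \<noteq> {}" "A \<subset> t \<union> u"
  have *: "\<exists>x\<in>A. \<exists>y\<in>s - A. x \<rightarrow>\<^bsub>G\<^esub> y" if s: "gconn G s" "A \<inter> s \<noteq> {}" "\<not> s \<subseteq> A" for s
  proof -
    have "A \<inter> s \<subset> s" using s(3) by blast
    then obtain x y where "x \<in> A \<inter> s" "y \<in> s - A \<inter> s" "x \<rightarrow>\<^bsub>G\<^esub> y"
      using connected_cutE[OF s(1), of "A \<inter> s"] s(2) by blast
    then show ?thesis by blast
  qed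
  show "\<exists>x\<in>A. \<exists>y\<in>t \<union> u - A. x \<rightarrow>\<^bsub>G\<^esub> y"
  proof (cases "A \<inter> t \<noteq> {} \<and> \<not> t \<subseteq> A")
    case True
    then show ?thesis using *[OF assms(1)] by blast
  next
    case False
    then have "A \<inter> u \<noteq> {} \<and> \<not> u \<subseteq> A" using A assms(3) by blast
    then show ?thesis using *[OF assms(2)] by blast
  qed
qed

lemma connected_Un_adj:
  assumes "gconn G t" "gconn G u" "x \<in> t" "y \<in> u" "x \<rightarrow>\<^bsub>G\<^esub> y"
  shows "gconn G (t \<union> u)"
proof -
  have "gconn G {x, y}"
    unfolding conn_cut
  proof (intro conjI allI impI)
    fix A assume "A \<noteq> {}" "A \<subset> {x, y}"
    then have "A = {x} \<and> x \<noteq> y \<or> A = {y} \<and> x \<noteq> y" by blast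
    then show "\<exists>w\<in>A. \<exists>z\<in>{x, y} - A. w \<rightarrow>\<^bsub>G\<^esub> z" using assms(5) graph_symmetric by auto
  qed simp
  then have "gconn G (t \<union> {x, y})" using connected_Un assms by blast
  then have "gconn G ((t \<union> {x, y}) \<union> u)" using connected_Un assms by blast
  moreover have "(t \<union> {x, y}) \<union> u = t \<union> u" using assms by blast
  ultimately show ?thesis by simp
qed

text \<open>This brings components into the language of cuts. By symmetry, the head of an arc also
  reaches its tail, so no arc leaves a strong component.\<close>

lemma sccs_verts_iff:
  "C \<in> sccs_verts \<longleftrightarrow> C \<subseteq> verts G \<and> gconn G C \<and> (\<forall>x\<in>C. \<forall>y. x \<rightarrow>\<^bsub>G\<^esub> y \<longrightarrow> y \<in> C)"
proof
  assume C: "C \<in> sccs_verts"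
  then have sub: "C \<subseteq> verts G" by (rule sccs_verts_subsets)
  have ne: "C \<noteq> {}" and re: "\<And>u v. u \<in> C \<Longrightarrow> v \<in> C \<Longrightarrow> u \<rightarrow>\<^sup>*\<^bsub>G\<^esub> v"
    using C unfolding in_sccs_verts_conv_reachable by blast+
  have cl: "y \<in> C" if "x \<in> C" "x \<rightarrow>\<^bsub>G\<^esub> y" for x y
  proof -
    have "x \<rightarrow>\<^sup>*\<^bsub>G\<^esub> y" "y \<rightarrow>\<^sup>*\<^bsub>G\<^esub> x" using that graph_symmetric by auto
    then show ?thesis using C that unfolding in_sccs_verts_conv_reachable by blast
  qed
  have "gconn G C"
    unfolding conn_cut
  proof (intro conjI allI impI)
    fix A assume A: "A \<noteq> {}" "A \<subset> C"
    then obtain u v where uv: "u \<in> A" "v \<in> C - A" by blast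
    show "\<exists>x\<in>A. \<exists>y\<in>C - A. x \<rightarrow>\<^bsub>G\<^esub> y"
    proof (rule ccontr)
      assume no: "\<not> ?thesis"
      have "u \<rightarrow>\<^sup>*\<^bsub>G\<^esub> v" using re uv A by blast
      then have "v \<in> A"
      proof (induction rule: reachable_induct)
        case (step y z)
        then show ?case using no cl[of y z] A by blast
      qed (use uv in blast)
      then show False using uv by blast
    qed
  qed (use ne in simp)
  then show "C \<subseteq> verts G \<and> gconn G C \<and> (\<forall>x\<in>C. \<forall>y. x \<rightarrow>\<^bsub>G\<^esub> y \<longrightarrow> y \<in> C)"
    using sub cl by blast
next
  assume C: "C \<subseteq> verts G \<and> gconn G C \<and> (\<forall>x\<in>C. \<forall>y. x \<rightarrow>\<^bsub>G\<^esub> y \<longrightarrow> y \<in> C)"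
  have stay: "v \<in> C" if "u \<rightarrow>\<^sup>*\<^bsub>G\<^esub> v" "u \<in> C" for u v
    using that by (induction rule: reachable_induct) (use C in blast)+
  have "u \<rightarrow>\<^sup>*\<^bsub>G\<^esub> v" if uv: "u \<in> C" "v \<in> C" for u v
  proof (rule ccontr)
    assume no: "\<not> u \<rightarrow>\<^sup>*\<^bsub>G\<^esub> v"
    let ?A = "{w. u \<rightarrow>\<^sup>*\<^bsub>G\<^esub> w}"
    have "u \<in> ?A" using uv C by auto
    moreover have "?A \<subset> C" using no uv stay by blast
    ultimately obtain x y where "x \<in> ?A" "y \<in> C - ?A" "x \<rightarrow>\<^bsub>G\<^esub> y"
      using C connected_cutE[of C ?A] by blast
    then show False using reachable_adj_trans by blast
  qed
  moreover have "C \<noteq> {}" using C unfolding conn_cut by blast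
  ultimately show "C \<in> sccs_verts"
    using stay unfolding in_sccs_verts_conv_reachable by blast
qed

text \<open>An arc leaving \<open>t\<close> would end in another tube \<open>u\<close> of
  \<open>T\<close>. Then \<open>t \<union> u\<close> is connected, so compatibility makes the two
  comparable, against the maximality of \<open>t\<close>.\<close>

lemma tubing_maximal_component:
  assumes T: "tubing G T" and t: "t \<in> T" and max: "\<And>u. u \<in> T \<Longrightarrow> \<not> t \<subset> u"
    and sub: "\<And>y. \<exists>x\<in>t. x \<rightarrow>\<^bsub>G\<^esub> y \<Longrightarrow> y \<in> \<Union>T"
  shows "t \<in> sccs_verts"
  unfolding sccs_verts_iff
proof (intro conjI ballI allI impI)
  have tt: "tube G t" using T t unfolding tubing_def tubes_def by blast
  show "t \<subseteq> verts G" "gconn G t" using tt unfolding tube_def by blast+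
  fix x y assume xy: "x \<in> t" "x \<rightarrow>\<^bsub>G\<^esub> y"
  then obtain u where u: "u \<in> T" "y \<in> u" using sub by blast
  show "y \<in> t"
  proof (rule ccontr)
    assume "y \<notin> t"
    then have "t \<noteq> u" using u by blast
    then have c: "tubes_compatible G t u"
      using T t u unfolding tubing_def pairwise_def by blast
    have "tube G u" using T u unfolding tubing_def tubes_def by blast
    then have "gconn G (t \<union> u)"
      using connected_Un_adj xy u tt unfolding tube_def by blast
    then have "t \<inter> u \<noteq> {}" using c unfolding tubes_compatible_def tubes_adjacent_def by blast
    then have "t \<subseteq> u \<or> u \<subseteq> t" using c unfolding tubes_compatible_def tubes_intersect_def by blast
    then show False using max[OF u(1)] u \<open>y \<notin> t\<close> \<open>t \<noteq> u\<close> by blast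
  qed
qed

text \<open>Compatibility is a condition on pairs, nestedness one on all subfamilies. They agree
  because a connected union that is not a member already produces an incompatible pair.\<close>

lemma nested_eq_tubing:
  assumes fin: "finite (verts G)"
  shows "nested (verts G) ((\<lambda>i. {i}) ` verts G \<union> tubes G) = {T. tubing G T}"
    (is "nested ?V ?B = _")
proof (intro set_eqI)
  fix T
  have Bconn: "gconn G t \<and> t \<subseteq> ?V \<and> t \<noteq> {}" if "t \<in> ?B" for t
    using that connected_singleton by (auto simp: tubes_def tube_def)
  have inB: "t \<in> ?B" if "gconn G t" "t \<subseteq> ?V" "t \<noteq> ?V" for t
    using that unfolding tubes_def tube_def conn_cut by blast
  show "T \<in> nested ?V ?B \<longleftrightarrow> T \<in> {T. tubing G T}"
  proof
    assume N: "T \<in> nested ?V ?B"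
    note TB = nestedD(1)[OF N] and TV = nestedD(2)[OF N] and att = nestedD(3)[OF N]
    have Tc: "gconn G t" "t \<subseteq> ?V" "t \<noteq> {}" if "t \<in> T" for t using Bconn TB that by blast+
    then have UTV: "\<Union>T \<subset> ?V" using TV by blast
    \<comment> \<open>A label that is not a tube exists only for the one-node graph; it is all of
      \<open>verts G\<close>, which \<open>UTV\<close> excludes.\<close>
    have "T \<subseteq> tubes G"
    proof
      fix t assume "t \<in> T"
      moreover from this have "t \<subseteq> \<Union>T" by blast
      ultimately show "t \<in> tubes G" using Tc UTV unfolding tubes_def tube_def by blast
    qed
    moreover have "pairwise (tubes_compatible G) T"
      unfolding pairwise_def
    proof (intro ballI impI)
      fix t u assume tu: "t \<in> T" "u \<in> T" "t \<noteq> u"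
      \<comment> \<open>Two intersecting tubes and two adjacent tubes both have a connected union,
        so the subfamily \<open>{t, u}\<close> settles both cases.\<close>
      have *: "t \<subseteq> u \<or> u \<subseteq> t" if "gconn G (t \<union> u)"
      proof -
        have "t \<union> u \<subseteq> \<Union>T" using tu by blast
        then have "t \<union> u \<subseteq> ?V" "t \<union> u \<noteq> ?V" using UTV by blast+
        then have "\<Union>{t, u} \<in> ?B" using inB[OF that] by (simp del: Un_iff)
        then have "\<Union>{t, u} \<in> {t, u}" using att[of "{t, u}"] tu by blast
        then show ?thesis by auto
      qed
      show "tubes_compatible G t u"
        using * connected_Un[of t u] Tc tu
        unfolding tubes_compatible_def tubes_intersect_def tubes_adjacent_def by blast
    qed
    moreover have "\<not> sccs_verts \<subseteq> T"
    proof
      assume "sccs_verts \<subseteq> T"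
      then have "?V \<subseteq> \<Union>T" using scc_of_in_sccs_verts in_scc_of_self by blast
      then show False using UTV by blast
    qed
    ultimately show "T \<in> {T. tubing G T}" unfolding tubing_def by blast
  next
    assume "T \<in> {T. tubing G T}"
    then have T: "tubing G T" by simp
    then have Tt: "T \<subseteq> tubes G" and comp: "pairwise (tubes_compatible G) T"
      and ns: "\<not> sccs_verts \<subseteq> T" unfolding tubing_def by blast+
    have "finite (tubes G)"
      by (rule finite_subset[of _ "Pow ?V"]) (use fin in \<open>auto simp: tubes_def tube_def\<close>)
    then have finT: "finite T" using Tt finite_subset by blast
    have maxi: "\<exists>t. x \<in> t \<and> t \<in> A \<and> (\<forall>u\<in>A. \<not> t \<subset> u)" if "x \<in> \<Union>A" "A \<subseteq> T" for x A
    proof -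
      have "finite {t \<in> A. x \<in> t}" "{t \<in> A. x \<in> t} \<noteq> {}"
        using finT that by (auto intro: finite_subset)
      then obtain t where "t \<in> {t \<in> A. x \<in> t}" "\<And>u. u \<in> {t \<in> A. x \<in> t} \<Longrightarrow> t \<subseteq> u \<Longrightarrow> t = u"
        by (metis (no_types, lifting) finite_has_maximal)
      then show ?thesis by blast
    qed
    have neV: "\<Union>T \<noteq> ?V"
    proof
      assume UT: "\<Union>T = ?V"
      \<comment> \<open>A maximal tube around a node of \<open>C\<close> is itself a component,
        because \<open>T\<close> covers everything an arc could lead to. Components being disjoint,
        it is \<open>C\<close>.\<close>
      have "sccs_verts \<subseteq> T"
      proof
        fix C assume C: "C \<in> sccs_verts"
        then obtain x where x: "x \<in> C" "x \<in> ?V"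
          using sccs_verts_subsets unfolding in_sccs_verts_conv_reachable by blast
        then obtain t where t: "x \<in> t" "t \<in> T" "\<forall>u\<in>T. \<not> t \<subset> u" using maxi[of x T] UT by blast
        have "t \<in> sccs_verts"
          by (rule tubing_maximal_component[OF T t(2)]) (use t UT in auto)
        then show "C \<in> T" using sccs_verts_disjoint[OF C] x t by blast
      qed
      then show False using ns by blast
    qed
    \<comment> \<open>An arc leads from a maximal member \<open>t\<close> of \<open>A\<close> to a
      node of another member \<open>u\<close>. Their union is connected, so they are comparable, and
      \<open>u\<close> would properly contain \<open>t\<close>.\<close>
    have att: "\<Union>A \<in> A" if A: "A \<subseteq> T" "\<Union>A \<in> ?B" for A
    proof (rule ccontr)
      assume no: "\<Union>A \<notin> A"
      have c: "gconn G (\<Union>A)" "\<Union>A \<noteq> {}" using Bconn[OF A(2)] by simp_all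
      then obtain x where "x \<in> \<Union>A" by (metis ex_in_conv)
      from maxi[OF this A(1)] obtain t where t: "x \<in> t" "t \<in> A" "\<forall>u\<in>A. \<not> t \<subset> u" by metis
      have "t \<noteq> \<Union>A" using no t(2) by metis
      then have "t \<noteq> {}" "t \<subset> \<Union>A" using t by (metis empty_iff, metis Union_upper psubsetI)
      then obtain x y where xy: "x \<in> t" "y \<in> \<Union>A - t" "x \<rightarrow>\<^bsub>G\<^esub> y" using connected_cutE[OF c(1)] by blast
      have "t \<in> T" using t A by blast
      obtain u where u: "u \<in> A" "y \<in> u" using xy by blast
      then have "u \<in> T" "t \<noteq> u" using A xy by blast+
      then have cc: "tubes_compatible G t u"
        using comp \<open>t \<in> T\<close> unfolding pairwise_def by blast
      have "gconn G (t \<union> u)"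
        using connected_Un_adj xy u Tt \<open>t \<in> T\<close> \<open>u \<in> T\<close> unfolding tubes_def tube_def by blast
      then have "t \<subseteq> u \<or> u \<subseteq> t"
        using cc unfolding tubes_compatible_def tubes_intersect_def tubes_adjacent_def by blast
      then show False using t u xy \<open>t \<noteq> u\<close> by blast
    qed
    show "T \<in> nested ?V ?B" by (rule nestedI[OF le_supI2[OF Tt] neV att])
  qed
qed

end

section \<open>Faces of a truncated polytope\<close>

text \<open>Take a minimal face containing \<open>x\<close>: a point on its relative frontier would
  lie in a smaller face.\<close>

lemma face_rel_interior_exists:
  fixes P :: "'c::euclidean_space set"
  assumes "polytope P" "x \<in> P"
  obtains G where "G face_of P" "x \<in> rel_interior G"
proof -
  have fin: "finite {G. G face_of P \<and> x \<in> G}"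
    by (rule finite_subset[OF _ finite_polytope_faces[OF assms(1)]]) auto
  moreover have "P \<in> {G. G face_of P \<and> x \<in> G}"
    using assms by (simp add: face_of_refl polytope_imp_convex)
  ultimately obtain G where G: "G face_of P" "x \<in> G"
    and min: "\<And>F. F face_of P \<Longrightarrow> x \<in> F \<Longrightarrow> F \<subseteq> G \<Longrightarrow> F = G"
    using finite_has_minimal[OF fin] by blast
  have pG: "polytope G" using face_of_polytope_polytope assms(1) G(1) by blast
  have "x \<notin> rel_frontier G"
  proof
    assume "x \<in> rel_frontier G"
    then obtain F where "F face_of G" "F \<noteq> G" "x \<in> F"
      using rel_frontier_of_polyhedron_alt[OF polytope_imp_polyhedron[OF pG]] by blast
    then show False using min face_of_trans[OF _ G(1)] face_of_imp_subset by blast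
  qed
  then have "x \<in> rel_interior G"
    using G(2) closure_subset unfolding rel_frontier_def by blast
  then show ?thesis using that G(1) by blast
qed

text \<open>Two faces that share a relative interior point are equal. So pick such a point
  \<open>x\<close> of \<open>X\<close> and the face \<open>G\<close> of \<open>P\<close> with
  \<open>x\<close> in its relative interior; \<open>X\<close> is the slice of \<open>G\<close> by
  the halfspace or by the hyperplane, depending on where \<open>x\<close> lies.\<close>

lemma face_of_Int_halfspace_le:
  fixes P :: "'c::euclidean_space set"
  assumes P: "polytope P" and X: "X face_of P \<inter> {x. a \<bullet> x \<le> b}" "X \<noteq> {}"
  obtains G where "G face_of P" "X = G \<inter> {x. a \<bullet> x \<le> b} \<or> X = G \<inter> {x. a \<bullet> x = b}"
proof -
  have "convex X" using X face_of_imp_convex by blast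
  then obtain x where x: "x \<in> rel_interior X" using X(2) rel_interior_eq_empty by blast
  then have xX: "x \<in> X" using rel_interior_subset by blast
  then have xP: "x \<in> P" "a \<bullet> x \<le> b" using X(1) face_of_imp_subset by blast+
  obtain G where G: "G face_of P" "x \<in> rel_interior G"
    using face_rel_interior_exists[OF P xP(1)] .
  have cG: "convex G" using G face_of_imp_convex by blast
  show ?thesis
  proof (cases "a \<bullet> x < b")
    case True
    have *: "x \<in> rel_interior {x. a \<bullet> x \<le> b}"
    proof -
      have "open {x. a \<bullet> x < b}" by (rule open_halfspace_lt)
      moreover have "{x. a \<bullet> x < b} \<subseteq> {x. a \<bullet> x \<le> b}" by auto
      ultimately have "x \<in> interior {x. a \<bullet> x \<le> b}" using True by (auto intro: interiorI)
      then show ?thesis using interior_subset_rel_interior by blast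
    qed
    have "G \<inter> {x. a \<bullet> x \<le> b} face_of P \<inter> {x. a \<bullet> x \<le> b}"
      using G(1) by (intro face_of_slice convex_halfspace_le)
    moreover have "x \<in> rel_interior (G \<inter> {x. a \<bullet> x \<le> b})"
      using convex_rel_interior_inter_two[OF cG convex_halfspace_le] G(2) * by blast
    ultimately have "X = G \<inter> {x. a \<bullet> x \<le> b}" using face_of_eq[OF X(1)] x by blast
    then show ?thesis using that G by blast
  next
    case False
    then have xb: "a \<bullet> x = b" using xP by simp
    have "G \<inter> {x. a \<bullet> x = b} face_of P \<inter> {x. a \<bullet> x \<le> b}"
      using face_of_Int_Int[OF G(1) hyperplane_face_of_halfspace_le] .
    moreover have "x \<in> rel_interior (G \<inter> {x. a \<bullet> x = b})"
      using convex_affine_rel_interior_Int[OF cG affine_hyperplane] G(2) xb by blast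
    ultimately have "X = G \<inter> {x. a \<bullet> x = b}" using face_of_eq[OF X(1)] x by blast
    then show ?thesis using that G by blast
  qed
qed

lemma aff_dim_Int_halfspace_le:
  fixes G :: "'c::euclidean_space set"
  assumes "convex G" "p \<in> G" "a \<bullet> p < b"
  shows "aff_dim (G \<inter> {x. a \<bullet> x \<le> b}) = aff_dim G"
proof (rule antisym)
  show "aff_dim (G \<inter> {x. a \<bullet> x \<le> b}) \<le> aff_dim G" by (simp add: aff_dim_subset)
  have "aff_dim G = aff_dim (G \<inter> {x. a \<bullet> x < b})"
    using aff_dim_convex_Int_open[OF assms(1) open_halfspace_lt, of a b] assms(2,3) by force
  also have "\<dots> \<le> aff_dim (G \<inter> {x. a \<bullet> x \<le> b})" by (rule aff_dim_subset) auto
  finally show "aff_dim G \<le> aff_dim (G \<inter> {x. a \<bullet> x \<le> b})" .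
qed

text \<open>Both points can be moved into the relative interior, which is connected, so the
  hyperplane meets it in some \<open>z\<close>. Near \<open>z\<close> the set fills its affine hull,
  and the affine hull loses one dimension because \<open>p\<close> is off the hyperplane.\<close>

lemma aff_dim_Int_hyperplane:
  fixes G :: "'c::euclidean_space set"
  assumes G: "convex G" and p: "p \<in> G" "a \<bullet> p < b" and q: "q \<in> G" "b < a \<bullet> q"
  shows "G \<inter> {x. a \<bullet> x = b} \<noteq> {}" "aff_dim (G \<inter> {x. a \<bullet> x = b}) = aff_dim G - 1"
proof -
  have cl: "G \<subseteq> closure (rel_interior G)"
    using convex_closure_rel_interior[OF G] closure_subset by blast
  have "\<exists>p'\<in>rel_interior G. a \<bullet> p' < b"
    using open_Int_closure_eq_empty[OF open_halfspace_lt, of a b "rel_interior G"] cl p by blast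
  moreover have "\<exists>q'\<in>rel_interior G. b < a \<bullet> q'"
    using open_Int_closure_eq_empty[OF open_halfspace_gt, of b a "rel_interior G"] cl q by blast
  ultimately obtain p' q' where pq: "p' \<in> rel_interior G" "a \<bullet> p' < b" "q' \<in> rel_interior G" "b < a \<bullet> q'"
    by blast
  then obtain z where z: "z \<in> rel_interior G" "a \<bullet> z = b"
    using connected_ivt_hyperplane[OF convex_connected[OF convex_rel_interior[OF G]] pq(1,3)
        less_imp_le[OF pq(2)] less_imp_le[OF pq(4)]] by blast
  then have zG: "z \<in> G" using rel_interior_subset by blast
  then show "G \<inter> {x. a \<bullet> x = b} \<noteq> {}" using z by blast
  let ?A = "affine hull G \<inter> {x. a \<bullet> x = b}"
  have "openin (top_of_set (affine hull G)) (rel_interior G)" by (rule openin_rel_interior)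
  then obtain U where U: "open U" "rel_interior G = affine hull G \<inter> U"
    by (auto simp: openin_open)
  have aff: "affine ?A" by (intro affine_Int affine_affine_hull affine_hyperplane)
  have "?A \<inter> U \<noteq> {}" using z U by blast
  then have "aff_dim ?A = aff_dim (?A \<inter> U)"
    using aff_dim_convex_Int_open[OF affine_imp_convex[OF aff] U(1)] by simp
  also have "?A \<inter> U \<subseteq> G \<inter> {x. a \<bullet> x = b}" using U rel_interior_subset by blast
  then have "aff_dim (?A \<inter> U) \<le> aff_dim (G \<inter> {x. a \<bullet> x = b})" by (rule aff_dim_subset)
  finally have ge: "aff_dim ?A \<le> aff_dim (G \<inter> {x. a \<bullet> x = b})" .
  have "G \<inter> {x. a \<bullet> x = b} \<subseteq> ?A" by (auto intro: hull_inc)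
  from aff_dim_subset[OF this] ge have "aff_dim (G \<inter> {x. a \<bullet> x = b}) = aff_dim ?A" by simp
  moreover have "z \<in> ?A" "p \<in> affine hull G" using z zG p(1) by (auto simp: hull_inc)
  then have "aff_dim ?A = aff_dim (affine hull G) - 1"
    unfolding aff_dim_affine_Int_hyperplane[OF affine_affine_hull] using p(2) by force
  ultimately show "aff_dim (G \<inter> {x. a \<bullet> x = b}) = aff_dim G - 1" by simp
qed

section \<open>Simple polytopes with labelled facets\<close>

text \<open>Intersecting with \<open>P\<close> means that a label need not carry the facet itself:
  old labels keep their sets while \<open>P\<close> shrinks, and a new label carries a whole
  hyperplane.\<close>

definition label_face :: "'c set \<Rightarrow> ('l \<Rightarrow> 'c set) \<Rightarrow> 'l set \<Rightarrow> 'c set" where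
  "label_face P F A = P \<inter> \<Inter>(F ` A)"

lemma label_face_empty [simp]: "label_face P F {} = P"
  by (simp add: label_face_def)

lemma label_face_Un: "label_face P F (A \<union> B) = label_face P F A \<inter> label_face P F B"
  unfolding label_face_def image_Un Inter_Un_distrib by blast

lemma label_face_antimono: "A \<subseteq> B \<Longrightarrow> label_face P F B \<subseteq> label_face P F A"
  unfolding label_face_def by (intro Int_mono Inter_anti_mono image_mono order_refl)

text \<open>
  A label whose facet is empty lies in \<open>L\<close> but in no member of \<open>K\<close>; this happens for the
  one-node graph.
\<close>

definition simple_labelling ::
  "'c::euclidean_space set \<Rightarrow> 'l set \<Rightarrow> 'l set set \<Rightarrow> ('l \<Rightarrow> 'c set) \<Rightarrow> bool" where
  "simple_labelling P L K F \<longleftrightarrow> polytope P \<and> finite L \<and>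
     (\<forall>A. A \<in> K \<longleftrightarrow> A \<subseteq> L \<and> label_face P F A \<noteq> {}) \<and>
     (\<forall>A\<in>K. label_face P F A face_of P \<and> aff_dim (label_face P F A) + int (card A) = aff_dim P) \<and>
     (\<forall>X. X face_of P \<longrightarrow> X \<noteq> {} \<longrightarrow> (\<exists>A\<in>K. X = label_face P F A))"

lemma simple_labellingD:
  assumes "simple_labelling P L K F"
  shows "polytope P" "finite L"
    and "A \<in> K \<longleftrightarrow> A \<subseteq> L \<and> label_face P F A \<noteq> {}"
    and "A \<in> K \<Longrightarrow> label_face P F A face_of P"
    and "A \<in> K \<Longrightarrow> aff_dim (label_face P F A) + int (card A) = aff_dim P"
    and "X face_of P \<Longrightarrow> X \<noteq> {} \<Longrightarrow> \<exists>A\<in>K. X = label_face P F A"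
proof -
  note d = assms[unfolded simple_labelling_def]
  note d3 = d[THEN conjunct2, THEN conjunct2]
  show "polytope P" by (rule d[THEN conjunct1])
  show "finite L" by (rule d[THEN conjunct2, THEN conjunct1])
  show "A \<in> K \<longleftrightarrow> A \<subseteq> L \<and> label_face P F A \<noteq> {}"
    by (rule d3[THEN conjunct1, rule_format])
  note d4 = bspec[OF d3[THEN conjunct2, THEN conjunct1]]
  show "label_face P F A face_of P" if "A \<in> K"
    by (rule d4[OF that, THEN conjunct1])
  show "aff_dim (label_face P F A) + int (card A) = aff_dim P" if "A \<in> K"
    by (rule d4[OF that, THEN conjunct2])
  show "\<exists>A\<in>K. X = label_face P F A" if "X face_of P" "X \<noteq> {}"
    by (rule d3[THEN conjunct2, THEN conjunct2, rule_format, OF that])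
qed

lemma simple_labelling_finite:
  assumes "simple_labelling P L K F" "A \<in> K"
  shows "finite A"
  using simple_labellingD(2)[OF assms(1)] simple_labellingD(3)[OF assms(1), of A] assms(2)
    finite_subset by blast

lemma simple_labelling_downclosed:
  assumes "simple_labelling P L K F" "A \<in> K" "B \<subseteq> A"
  shows "B \<in> K"
  using simple_labellingD(3)[OF assms(1), of A] simple_labellingD(3)[OF assms(1), of B] assms(2)
    label_face_antimono[OF assms(3), of P F] assms(3) by blast

text \<open>If the face of \<open>A\<close> lies in that of \<open>B\<close>, then \<open>A\<close>
  and \<open>A \<union> B\<close> define the same face. The dimension formula gives them equal size,
  so they coincide.\<close>

lemma simple_labelling_subset_iff:
  assumes lab: "simple_labelling P L K F" and A: "A \<in> K" and B: "B \<in> K"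
  shows "label_face P F A \<subseteq> label_face P F B \<longleftrightarrow> B \<subseteq> A"
proof
  assume "label_face P F A \<subseteq> label_face P F B"
  then have eq: "label_face P F (A \<union> B) = label_face P F A"
    unfolding label_face_Un by blast
  have AB: "A \<union> B \<in> K"
    using simple_labellingD(3)[OF lab, of A] simple_labellingD(3)[OF lab, of B]
      simple_labellingD(3)[OF lab, of "A \<union> B"] A B eq by simp
  then have "card (A \<union> B) = card A"
    using simple_labellingD(5)[OF lab AB] simple_labellingD(5)[OF lab A] eq by simp
  then have "A = A \<union> B"
    using card_subset_eq[of "A \<union> B" A] simple_labelling_finite[OF lab AB] by auto
  then show "B \<subseteq> A" by blast
qed (rule label_face_antimono)

text \<open>A vertex has dimension 0, so its label set has as many elements as the dimension of
  \<open>P\<close>, and these labels are exactly the facets through it.\<close>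

lemma simple_labelling_simple_polytope:
  assumes lab: "simple_labelling P L K F"
  shows "simple_polytope P"
  unfolding simple_polytope_def
proof (intro conjI allI impI)
  show "polytope P" by (rule simple_labellingD(1)[OF lab])
  fix v assume "v extreme_point_of P"
  then have "{v} face_of P" by (simp add: face_of_singleton)
  then obtain A where A: "A \<in> K" "{v} = label_face P F A" using simple_labellingD(6)[OF lab] by blast
  have facet: "X facet_of P \<and> v \<in> X \<longleftrightarrow> (\<exists>i\<in>A. X = label_face P F {i})" for X
  proof
    assume X: "X facet_of P \<and> v \<in> X"
    then obtain B where B: "B \<in> K" "X = label_face P F B"
      using simple_labellingD(6)[OF lab] unfolding facet_of_def by blast
    have "card B = 1" using simple_labellingD(5)[OF lab B(1)] X B(2) unfolding facet_of_def by simp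
    then obtain i where i: "B = {i}" using card_1_singletonE by blast
    have "label_face P F A \<subseteq> label_face P F B"
      unfolding A(2)[symmetric] using X B(2) by blast
    then have "B \<subseteq> A" using simple_labelling_subset_iff[OF lab A(1) B(1)] by blast
    then show "\<exists>i\<in>A. X = label_face P F {i}" using B i by blast
  next
    assume "\<exists>i\<in>A. X = label_face P F {i}"
    then obtain i where i: "i \<in> A" "X = label_face P F {i}" by blast
    have iK: "{i} \<in> K" using simple_labelling_downclosed[OF lab A(1)] i by blast
    have "v \<in> X" using A(2) i label_face_antimono[of "{i}" A P F] by blast
    then show "X facet_of P \<and> v \<in> X"
      using simple_labellingD(4)[OF lab iK] simple_labellingD(5)[OF lab iK] i(2)
      unfolding facet_of_def by auto
  qed
  have inj: "inj_on (\<lambda>i. label_face P F {i}) A"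
  proof (rule inj_onI)
    fix i j assume ij: "i \<in> A" "j \<in> A" "label_face P F {i} = label_face P F {j}"
    then have "{i} \<in> K" "{j} \<in> K" using simple_labelling_downclosed[OF lab A(1)] by blast+
    then have "{i} \<subseteq> {j}" using simple_labelling_subset_iff[OF lab, of "{j}" "{i}"] ij(3) by simp
    then show "i = j" by simp
  qed
  have "{X. X facet_of P \<and> v \<in> X} = (\<lambda>i. label_face P F {i}) ` A" using facet by blast
  then have "card {X. X facet_of P \<and> v \<in> X} = card A" using card_image[OF inj] by simp
  then show "int (card {X. X facet_of P \<and> v \<in> X}) = aff_dim P"
    using simple_labellingD(5)[OF lab A(1)] A(2) by (metis aff_dim_sing add_0)
qed

lemma simple_labelling_faces:
  assumes lab: "simple_labelling P L K F"
  shows "poset_isomorphic (faces P) (\<subseteq>) K (\<lambda>A B. B \<subseteq> A)"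
proof -
  have inj: "inj_on (label_face P F) K"
  proof (rule inj_onI)
    fix A B assume AB: "A \<in> K" "B \<in> K" "label_face P F A = label_face P F B"
    then show "A = B"
      using simple_labelling_subset_iff[OF lab AB(1,2)] simple_labelling_subset_iff[OF lab AB(2,1)]
      by auto
  qed
  have im: "(label_face P F) ` K = faces P"
  proof
    show "(label_face P F) ` K \<subseteq> faces P"
    proof
      fix X assume "X \<in> label_face P F ` K"
      then obtain A where A: "A \<in> K" "X = label_face P F A" by blast
      then show "X \<in> faces P"
        using simple_labellingD(3)[OF lab, of A] simple_labellingD(4)[OF lab A(1)]
        by (simp add: faces_def)
    qed
    show "faces P \<subseteq> (label_face P F) ` K"
    proof
      fix X assume "X \<in> faces P"
      then have "\<exists>A\<in>K. X = label_face P F A"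
        using simple_labellingD(6)[OF lab, of X] by (simp add: faces_def)
      then show "X \<in> label_face P F ` K" by blast
    qed
  qed
  have bij: "bij_betw (inv_into K (label_face P F)) (faces P) K"
    by (rule bij_betw_inv_into) (simp add: bij_betw_def inj im)
  show ?thesis
    unfolding poset_isomorphic_def
  proof (intro exI[of _ "inv_into K (label_face P F)"] conjI ballI bij)
    fix X Y assume XY: "X \<in> faces P" "Y \<in> faces P"
    obtain A where A: "A \<in> K" "X = label_face P F A" using XY(1) unfolding im[symmetric] by blast
    obtain B where B: "B \<in> K" "Y = label_face P F B" using XY(2) unfolding im[symmetric] by blast
    show "X \<subseteq> Y \<longleftrightarrow> inv_into K (label_face P F) Y \<subseteq> inv_into K (label_face P F) X"
      unfolding A(2) B(2) inv_into_f_f[OF inj A(1)] inv_into_f_f[OF inj B(1)]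
      by (rule simple_labelling_subset_iff[OF lab A(1) B(1)])
  qed
qed

text \<open>Vertices of a face are vertices of \<open>P\<close>, and halfspaces and \<open>f\<close>
  are convex, so the condition on vertices passes to all faces. For the last claim,
  \<open>G \<inter> f\<close> is a nonempty face and hence has a vertex.\<close>

lemma truncation_vertices:
  fixes P :: "'c::euclidean_space set"
  assumes P: "polytope P" and f: "f face_of P" and G: "G face_of P"
    and vert: "\<And>v. v extreme_point_of P \<Longrightarrow> (a \<bullet> v \<le> b \<longleftrightarrow> v \<notin> f) \<and> a \<bullet> v \<noteq> b"
  shows "G \<subseteq> f \<Longrightarrow> G \<subseteq> {x. b < a \<bullet> x}"
    and "G \<inter> f = {} \<Longrightarrow> G \<subseteq> {x. a \<bullet> x < b}"
    and "\<not> G \<subseteq> f \<Longrightarrow> \<exists>p\<in>G. a \<bullet> p < b"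
    and "G \<inter> f \<noteq> {} \<Longrightarrow> \<exists>q\<in>G. b < a \<bullet> q"
proof -
  have pG: "polytope G" using face_of_polytope_polytope P G by blast
  have hull: "G = convex hull {v. v extreme_point_of G}"
    using Krein_Milman_Minkowski polytope_imp_compact polytope_imp_convex pG by blast
  have ext: "v extreme_point_of P" "v \<in> G" if "v extreme_point_of G" for v
    using that extreme_point_of_face[OF G] by blast+
  show "G \<subseteq> {x. b < a \<bullet> x}" if "G \<subseteq> f"
  proof -
    have "{v. v extreme_point_of G} \<subseteq> {x. b < a \<bullet> x}" using ext vert that by force
    then show ?thesis by (subst hull, intro hull_minimal) (simp_all add: convex_halfspace_gt)
  qed
  show "G \<subseteq> {x. a \<bullet> x < b}" if "G \<inter> f = {}"
  proof -
    have "{v. v extreme_point_of G} \<subseteq> {x. a \<bullet> x < b}" using ext vert that by force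
    then show ?thesis by (subst hull, intro hull_minimal) (simp_all add: convex_halfspace_lt)
  qed
  show "\<exists>p\<in>G. a \<bullet> p < b" if "\<not> G \<subseteq> f"
  proof -
    have "\<not> {v. v extreme_point_of G} \<subseteq> f"
      using that hull face_of_imp_convex[OF f] by (metis hull_minimal)
    then obtain v where "v extreme_point_of G" "v \<notin> f" by blast
    then show ?thesis using ext vert by force
  qed
  show "\<exists>q\<in>G. b < a \<bullet> q" if ne: "G \<inter> f \<noteq> {}"
  proof -
    have Gf: "G \<inter> f face_of P" using face_of_Int G f by blast
    then have "polytope (G \<inter> f)" using face_of_polytope_polytope P by blast
    then obtain v where "v extreme_point_of (G \<inter> f)"
      using extreme_point_exists_convex[OF polytope_imp_compact polytope_imp_convex ne] by blast
    then have "v extreme_point_of P" "v \<in> G \<inter> f" using extreme_point_of_face[OF Gf] by blast+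
    then show ?thesis using vert by force
  qed
qed

text \<open>A face of \<open>Q\<close> is a face of \<open>P\<close> cut by the halfspace, with
  unchanged dimension and labels, or by the hyperplane, with one dimension less and the extra label
  \<open>n\<close>. The two parts of \<open>stellar\<close> list the cases in which these are
  nonempty.\<close>

lemma simple_labelling_truncation:
  fixes P :: "'c::euclidean_space set"
  assumes lab: "simple_labelling P L K F"
    and S: "S \<in> K" "S \<noteq> {}" and n: "n \<notin> L \<or> S = {n}"
    and tr: "truncation P (label_face P F S) Q"
  shows "\<exists>F'. simple_labelling Q (insert n L) (stellar S n K) F' \<and> (\<forall>i. i \<noteq> n \<longrightarrow> F' i = F i)"
proof -
  let ?f = "label_face P F S"
  obtain a b where Q: "Q = P \<inter> {x. a \<bullet> x \<le> b}"
    and vert: "\<And>v. v extreme_point_of P \<Longrightarrow> (a \<bullet> v \<le> b \<longleftrightarrow> v \<notin> ?f) \<and> a \<bullet> v \<noteq> b"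
    using tr unfolding truncation_def by auto
  let ?H = "{x. a \<bullet> x \<le> b}" and ?h = "{x. a \<bullet> x = b}"
  note P = simple_labellingD(1)[OF lab]
  have f: "?f face_of P" using simple_labellingD(4)[OF lab S(1)] .
  have inL: "A \<subseteq> L" if "A \<in> K" for A using simple_labellingD(3)[OF lab, of A] that by blast
  \<comment> \<open>If \<open>S = {n}\<close>, the label sets with \<open>n\<close> are those of the
    faces cut off, so \<open>n\<close> is free for reuse.\<close>
  have nK: "n \<notin> A" if "A \<in> K" "\<not> S \<subseteq> A" for A using n inL[OF that(1)] that(2) by blast
  note tv = truncation_vertices[OF P f _ vert]
  have conv: "convex (label_face P F A)" if "A \<in> K" for A
    using simple_labellingD(4)[OF lab that] face_of_imp_convex by blast
  have sub: "label_face P F A \<subseteq> ?f \<longleftrightarrow> S \<subseteq> A" if "A \<in> K" for A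
    using simple_labelling_subset_iff[OF lab that S(1)] .
  have meet: "label_face P F A \<inter> ?f \<noteq> {} \<longleftrightarrow> A \<union> S \<in> K" if "A \<in> K" for A
  proof -
    have "label_face P F A \<inter> ?f = label_face P F (A \<union> S)" by (simp add: label_face_Un)
    then show ?thesis using simple_labellingD(3)[OF lab, of "A \<union> S"] inL[OF that] inL[OF S(1)] by simp
  qed
  have low: "label_face P F A \<inter> ?H \<noteq> {} \<longleftrightarrow> \<not> S \<subseteq> A" if "A \<in> K" for A
  proof
    assume "label_face P F A \<inter> ?H \<noteq> {}"
    then show "\<not> S \<subseteq> A"
      using tv(1)[OF simple_labellingD(4)[OF lab that]] sub[OF that] by fastforce
  next
    assume "\<not> S \<subseteq> A"
    then show "label_face P F A \<inter> ?H \<noteq> {}"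
      using tv(3)[OF simple_labellingD(4)[OF lab that]] sub[OF that] by fastforce
  qed
  have lowdim: "aff_dim (label_face P F A \<inter> ?H) = aff_dim (label_face P F A)" if A: "A \<in> K" "\<not> S \<subseteq> A" for A
  proof -
    obtain p where "p \<in> label_face P F A" "a \<bullet> p < b"
      using tv(3)[OF simple_labellingD(4)[OF lab A(1)]] sub[OF A(1)] A(2) by blast
    then show ?thesis using aff_dim_Int_halfspace_le[OF conv[OF A(1)]] by blast
  qed
  have mid: "label_face P F A \<inter> ?h \<noteq> {} \<and> aff_dim (label_face P F A \<inter> ?h) = aff_dim (label_face P F A) - 1"
    if A: "A \<in> K" "\<not> S \<subseteq> A" "A \<union> S \<in> K" for A
  proof -
    obtain p where p: "p \<in> label_face P F A" "a \<bullet> p < b"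
      using tv(3)[OF simple_labellingD(4)[OF lab A(1)]] sub[OF A(1)] A(2) by blast
    obtain q where q: "q \<in> label_face P F A" "b < a \<bullet> q"
      using tv(4)[OF simple_labellingD(4)[OF lab A(1)]] meet[OF A(1)] A(3) by blast
    show ?thesis using aff_dim_Int_hyperplane[OF conv[OF A(1)] p q] by blast
  qed
  have midD: "\<not> S \<subseteq> A \<and> A \<union> S \<in> K" if "A \<in> K" "label_face P F A \<inter> ?h \<noteq> {}" for A
  proof
    have "label_face P F A \<inter> ?H \<noteq> {}" using that(2) by fastforce
    then show "\<not> S \<subseteq> A" using low[OF that(1)] by blast
    show "A \<union> S \<in> K"
    proof (rule ccontr)
      assume "A \<union> S \<notin> K"
      then have "label_face P F A \<subseteq> {x. a \<bullet> x < b}"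
        using tv(2)[OF simple_labellingD(4)[OF lab that(1)]] meet[OF that(1)] by blast
      then show False using that(2) by force
    qed
  qed
  \<comment> \<open>The bounding hyperplane represents the new facet; for \<open>S = {n}\<close> it
    overwrites the facet that was cut off.\<close>
  define F' where "F' = F(n := ?h)"
  have \<phi>'0: "label_face Q F' A = label_face P F A \<inter> ?H" if "n \<notin> A" for A
  proof -
    have "F' ` A = F ` A" using that by (auto simp: F'_def)
    then show ?thesis by (auto simp: Q label_face_def)
  qed
  have \<phi>'1: "label_face Q F' (insert n A) = label_face P F A \<inter> ?h" if "n \<notin> A" for A
  proof -
    have "F' ` A = F ` A" using that by (auto simp: F'_def)
    moreover have "F' n = ?h" by (simp add: F'_def)
    ultimately show ?thesis by (auto simp: Q label_face_def)
  qed
  have e: "{} \<in> K" using simple_labelling_downclosed[OF lab S(1)] by blast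
  \<comment> \<open>As \<open>S\<close> is nonempty, the truncated face is not all of
    \<open>P\<close>, so the dimension survives.\<close>
  have "aff_dim (label_face P F {} \<inter> ?H) = aff_dim (label_face P F {})" using lowdim[OF e] S(2) by blast
  then have dimQ: "aff_dim Q = aff_dim P" by (simp add: Q)
  have st0: "A \<in> stellar S n K \<longleftrightarrow> A \<in> K \<and> \<not> S \<subseteq> A" if "n \<notin> A" for A
    using that by (auto simp: stellar_def)
  have st1: "insert n A \<in> stellar S n K \<longleftrightarrow> A \<in> K \<and> \<not> S \<subseteq> A \<and> A \<union> S \<in> K" if "n \<notin> A" for A
    using that by (simp add: stellar_def image_iff) (metis insert_ident)
  have finA: "finite A" if "A \<in> K" for A using simple_labelling_finite[OF lab that] .
  have "simple_labelling Q (insert n L) (stellar S n K) F'"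
    unfolding simple_labelling_def
  proof (intro conjI allI ballI impI)
    show "polytope Q" unfolding Q by (intro polytope_Int_polyhedron P polyhedron_halfspace_le)
    show "finite (insert n L)" using simple_labellingD(2)[OF lab] by simp
  next
    fix A
    show "A \<in> stellar S n K \<longleftrightarrow> A \<subseteq> insert n L \<and> label_face Q F' A \<noteq> {}"
    proof (cases "n \<in> A")
      case False
      then have AL: "A \<subseteq> insert n L \<longleftrightarrow> A \<subseteq> L" by blast
      show ?thesis
      proof (cases "A \<in> K")
        case True
        then show ?thesis unfolding st0[OF False] \<phi>'0[OF False] AL
          using low[OF True] inL[OF True] by blast
      next
        case nK: False
        then have "A \<subseteq> L \<longrightarrow> label_face P F A = {}" using simple_labellingD(3)[OF lab, of A] by blast
        then show ?thesis unfolding st0[OF False] \<phi>'0[OF False] AL using nK by blast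
      qed
    next
      case True
      define B where "B = A - {n}"
      have B: "A = insert n B" "n \<notin> B" using True by (auto simp: B_def)
      have BL: "insert n B \<subseteq> insert n L \<longleftrightarrow> B \<subseteq> L" using B(2) by blast
      show ?thesis
      proof (cases "B \<in> K")
        case True
        then show ?thesis unfolding B(1) st1[OF B(2)] \<phi>'1[OF B(2)] BL
          using mid[OF True] midD[OF True] inL[OF True] by blast
      next
        case nK: False
        then have "B \<subseteq> L \<longrightarrow> label_face P F B = {}" using simple_labellingD(3)[OF lab, of B] by blast
        then show ?thesis unfolding B(1) st1[OF B(2)] \<phi>'1[OF B(2)] BL using nK by blast
      qed
    qed
  next
    fix A assume A: "A \<in> stellar S n K"
    show "label_face Q F' A face_of Q"
    proof (cases "n \<in> A")
      case False
      then have "A \<in> K" using A st0 by blast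
      then show ?thesis unfolding \<phi>'0[OF False] unfolding Q
        by (intro face_of_slice convex_halfspace_le simple_labellingD(4)[OF lab])
    next
      case True
      define B where "B = A - {n}"
      have B: "A = insert n B" "n \<notin> B" using True by (auto simp: B_def)
      then have "B \<in> K" using A st1 by blast
      then show ?thesis unfolding B(1) \<phi>'1[OF B(2)] unfolding Q
        by (intro face_of_Int_Int hyperplane_face_of_halfspace_le simple_labellingD(4)[OF lab])
    qed
    show "aff_dim (label_face Q F' A) + int (card A) = aff_dim Q"
    proof (cases "n \<in> A")
      case False
      then have "A \<in> K" "\<not> S \<subseteq> A" using A st0 by blast+
      then show ?thesis unfolding \<phi>'0[OF False] dimQ
        using simple_labellingD(5)[OF lab] lowdim by simp
    next
      case True
      define B where "B = A - {n}"
      have B: "A = insert n B" "n \<notin> B" using True by (auto simp: B_def)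
      then have BK: "B \<in> K" "\<not> S \<subseteq> B" "B \<union> S \<in> K" using A st1 by blast+
      then show ?thesis unfolding B(1) \<phi>'1[OF B(2)] dimQ
        using simple_labellingD(5)[OF lab BK(1)] mid[OF BK] B(2) finA[OF BK(1)] by simp
    qed
  next
    fix X assume X: "X face_of Q" "X \<noteq> {}"
    then obtain G where G: "G face_of P" "X = G \<inter> ?H \<or> X = G \<inter> ?h"
      using face_of_Int_halfspace_le[OF P] unfolding Q by blast
    then have "G \<noteq> {}" using X(2) by blast
    then obtain A where A: "A \<in> K" "G = label_face P F A" using simple_labellingD(6)[OF lab G(1)] by blast
    from G(2) show "\<exists>A\<in>stellar S n K. X = label_face Q F' A"
    proof
      assume XH: "X = G \<inter> ?H"
      then have "\<not> S \<subseteq> A" using low[OF A(1)] X(2) A(2) by simp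
      then have "A \<in> stellar S n K" "label_face Q F' A = X"
        using nK[OF A(1)] A st0 \<phi>'0 XH by simp_all
      then show ?thesis by blast
    next
      assume Xh: "X = G \<inter> ?h"
      then have "\<not> S \<subseteq> A \<and> A \<union> S \<in> K" using midD[OF A(1)] X(2) A(2) by simp
      then have "insert n A \<in> stellar S n K" "label_face Q F' (insert n A) = X"
        using nK[OF A(1)] A st1 \<phi>'1 Xh by simp_all
      then show ?thesis by blast
    qed
  qed
  moreover have "\<forall>i. i \<noteq> n \<longrightarrow> F' i = F i" by (simp add: F'_def)
  ultimately show ?thesis by blast
qed

section \<open>Iterated truncation of the simplex\<close>

text \<open>For subsets of an affinely independent set, convex hulls commute with
  intersections.\<close>

lemma simplex_face_eq_convex_hull:
  fixes c :: "'a \<Rightarrow> 'c::euclidean_space"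
  assumes ind: "\<not> affine_dependent (c ` V)" and inj: "inj_on c V" and S: "S \<subseteq> V"
  shows "simplex_face c V S = convex hull (c ` (V - S))"
proof -
  \<comment> \<open>Including the full vertex set keeps the family nonempty for
    \<open>S = {}\<close> and matches the first factor of \<open>simplex_face\<close>.\<close>
  let ?\<F> = "insert (c ` V) ((\<lambda>i. c ` (V - {i})) ` S)"
  have U: "\<Union>?\<F> = c ` V" by auto
  have "\<Inter>?\<F> = c ` (V - S)"
  proof
    show "\<Inter>?\<F> \<subseteq> c ` (V - S)"
    proof
      fix x assume x: "x \<in> \<Inter>?\<F>"
      then obtain i where i: "i \<in> V" "x = c i" by auto
      have "i \<notin> S"
      proof
        assume "i \<in> S"
        then obtain j where "j \<in> V - {i}" "x = c j" using x by auto
        then show False using i inj by (auto dest: inj_onD)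
      qed
      then show "x \<in> c ` (V - S)" using i by blast
    qed
  qed auto
  then have "convex hull (c ` (V - S)) = (\<Inter>T\<in>?\<F>. convex hull T)"
    using convex_hull_Inter[of ?\<F>] ind U by simp
  then show ?thesis by (simp add: simplex_face_def simplex_facet_def)
qed

lemma aff_dim_simplex_face:
  fixes c :: "'a \<Rightarrow> 'c::euclidean_space"
  assumes "finite V" "\<not> affine_dependent (c ` V)" "inj_on c V" "S \<subseteq> V"
  shows "aff_dim (simplex_face c V S) = int (card V) - int (card S) - 1"
proof -
  have "\<not> affine_dependent (c ` (V - S))"
    by (rule affine_independent_subset[OF assms(2)]) auto
  then have "aff_dim (c ` (V - S)) = int (card (c ` (V - S))) - 1"
    using aff_dim_affine_independent by fastforce
  also have "card (c ` (V - S)) = card V - card S"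
    using assms card_image[OF inj_on_subset[OF assms(3)], of "V - S"]
    by (simp add: card_Diff_subset finite_subset)
  finally show ?thesis
    using card_mono[OF assms(1,4)]
    by (simp add: simplex_face_eq_convex_hull[OF assms(2-4)] aff_dim_convex_hull of_nat_diff)
qed

text \<open>With one-node labels only, the subfamily condition of \<open>nested\<close> is
  automatic. Writing the labelling as an intersection over \<open>t\<close> makes the face of
  \<open>A\<close> equal to \<open>simplex_face c V (\<Union>A)\<close>.\<close>

lemma simple_labelling_simplex:
  fixes c :: "'a \<Rightarrow> 'c::euclidean_space"
  assumes fin: "finite V" and ind: "\<not> affine_dependent (c ` V)" and inj: "inj_on c V"
  defines "L \<equiv> (\<lambda>i. {i}) ` V"
  shows "simple_labelling (convex hull (c ` V)) L (nested V L) (\<lambda>t. \<Inter>i\<in>t. simplex_facet c V i)"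
    (is "simple_labelling ?P L ?K ?F")
proof -
  have face: "label_face ?P ?F A = simplex_face c V (\<Union>A)" for A
    by (simp add: label_face_def simplex_face_def)
  have UL: "\<Union>A \<subseteq> V" if "A \<subseteq> L" for A using that by (auto simp: L_def)
  have hull: "label_face ?P ?F A = convex hull (c ` (V - \<Union>A))" if "A \<subseteq> L" for A
    unfolding face by (rule simplex_face_eq_convex_hull[OF ind inj UL[OF that]])
  have K: "A \<in> ?K \<longleftrightarrow> A \<subseteq> L \<and> \<Union>A \<noteq> V" for A
  proof
    assume "A \<in> ?K"
    then show "A \<subseteq> L \<and> \<Union>A \<noteq> V" using nestedD(1,2) by blast
  next
    assume A: "A \<subseteq> L \<and> \<Union>A \<noteq> V"
    show "A \<in> ?K"
    proof (rule nestedI)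
      fix C assume C: "C \<subseteq> A" "\<Union>C \<in> L"
      then obtain i where i: "\<Union>C = {i}" by (auto simp: L_def)
      then obtain t where t: "t \<in> C" "i \<in> t" by (metis UnionE insertI1)
      then have "t = {i}" using A C(1) by (auto simp: L_def)
      then show "\<Union>C \<in> C" using t i by simp
    qed (use A in auto)
  qed
  have card: "card (\<Union>A) = card A" if "A \<subseteq> L" for A
  proof -
    have "A = (\<lambda>i. {i}) ` \<Union>A" using that by (force simp: L_def)
    then have "card A = card ((\<lambda>i. {i}) ` \<Union>A)" by simp
    then show ?thesis by (simp add: card_image)
  qed
  have polyP: "polytope ?P" using fin by (simp add: polytope_convex_hull)
  have dim: "aff_dim ?P = int (card V) - 1"
    using aff_dim_simplex_face[OF fin ind inj, of "{}"]
    by (simp add: simplex_face_def)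
  show ?thesis
    unfolding simple_labelling_def
  proof (intro conjI allI ballI impI)
    show "polytope ?P" by (rule polyP)
    show "finite L" using fin by (simp add: L_def)
  next
    fix A
    show "A \<in> ?K \<longleftrightarrow> A \<subseteq> L \<and> label_face ?P ?F A \<noteq> {}"
    proof (cases "A \<subseteq> L")
      case True
      then show ?thesis using hull[OF True] UL[OF True] by (auto simp: K)
    qed (simp add: K)
  next
    fix A assume "A \<in> ?K"
    then have A: "A \<subseteq> L" using K by blast
    show "label_face ?P ?F A face_of ?P"
      unfolding face by (rule simplex_face_face_of[OF ind inj UL[OF A]])
    show "aff_dim (label_face ?P ?F A) + int (card A) = aff_dim ?P"
      unfolding face aff_dim_simplex_face[OF fin ind inj UL[OF A]] card[OF A] dim by simp
  next
    fix X assume X: "X face_of ?P" "X \<noteq> {}"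
    then obtain d where d: "d \<subseteq> c ` V" "X = convex hull d"
      using face_of_convex_hull_affine_independent[OF ind] by blast
    \<comment> \<open>The face spanned by \<open>d\<close> lies in the facets opposite to the
      vertices missing from \<open>d\<close>.\<close>
    define A where "A = (\<lambda>i. {i}) ` {i \<in> V. c i \<notin> d}"
    have AL: "A \<subseteq> L" by (auto simp: A_def L_def)
    have "c ` (V - \<Union>A) = d" using d(1) by (auto simp: A_def)
    then have eq: "X = label_face ?P ?F A" using hull[OF AL] d(2) by simp
    moreover have "\<Union>A \<noteq> V"
    proof
      assume "\<Union>A = V"
      then show False using hull[OF AL] eq X(2) by simp
    qed
    ultimately show "\<exists>A\<in>?K. X = label_face ?P ?F A" using K AL by blast
  qed
qed

text \<open>\<open>E\<close> holds the tubes already cut off and \<open>ts\<close> those still to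
  come. The hypothesis on \<open>F {i}\<close> ties the labelling to the initial simplex, whose
  faces the truncations refer to.\<close>

lemma truncations_simple_labelling:
  fixes G :: "('a, 'b) pre_digraph" and c :: "'a \<Rightarrow> 'c::euclidean_space"
  defines "V \<equiv> verts G" and "D \<equiv> (\<lambda>i. {i}) ` verts G"
  assumes G: "sym_digraph G" and fin: "finite V"
    and "truncations P (map (simplex_face c V) ts) R"
    and "simple_labelling P (D \<union> E) (nested V (D \<union> E)) F"
    and "P \<subseteq> convex hull (c ` V)" "E \<union> set ts = tubes G" "E \<inter> set ts = {}" "distinct ts"
    and "\<And>i. i \<in> V \<Longrightarrow> {i} \<notin> E \<Longrightarrow> F {i} = simplex_facet c V i"
    and "\<And>t u. t \<in> set ts \<Longrightarrow> u \<in> E \<Longrightarrow> card t \<le> card u"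
    and "sorted_wrt (\<lambda>u t. card t \<le> card u) ts"
  shows "\<exists>F. simple_labelling R (D \<union> tubes G) (nested V (D \<union> tubes G)) F"
  using assms(5-)
proof (induction ts arbitrary: P E F)
  case Nil
  then have "R = P" "E = tubes G" by (auto elim: truncations.cases)
  then show ?case using Nil.prems(2) by blast
next
  case (Cons t ts)
  interpret sym_digraph G by fact
  let ?B = "D \<union> E"
  from Cons.prems(1) obtain Q where
    Q: "truncation P (P \<inter> simplex_face c V t) Q" "truncations Q (map (simplex_face c V) ts) R"
    by (auto elim: truncations.cases)
  note lab = Cons.prems(2)
  have tube: "tube G s" if "s \<in> E \<or> s = t" for s
    using that Cons.prems(4) by (auto simp: tubes_def)
  have t: "t \<noteq> {}" "t \<subset> V" "t \<notin> E" "finite t"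
    using tube[of t] Cons.prems(5) fin by (auto simp: tube_def V_def intro: finite_subset)
  define S where "S = (\<lambda>i. {i}) ` t"
  have S: "S \<noteq> {}" "S \<subseteq> D" using t by (auto simp: S_def D_def V_def)
  have tE: "card t \<le> card u" if "u \<in> E" for u using Cons.prems(8)[OF _ that] by simp
  have conn: "gconn G u" "u \<subseteq> V" if "u \<in> ?B" for u
    using that tube[of u] connected_singleton by (auto simp: D_def V_def tube_def)
  \<comment> \<open>A one-node tube in \<open>E\<close> is at least as large as \<open>t\<close>, so
    it would be \<open>t\<close> itself. Hence the face to be cut is an intersection of original
    facets, that is, the label face of \<open>S\<close>.\<close>
  have noE: "{i} \<notin> E" if "i \<in> t" for i
  proof
    assume i: "{i} \<in> E"
    have "{i} = t" using card_seteq[OF t(4), of "{i}"] tE[OF i] that by simp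
    then show False using i t(3) by simp
  qed
  have facets: "F {i} = simplex_facet c V i" if "i \<in> t" for i
    using Cons.prems(7)[OF _ noE[OF that]] that t(2) by blast
  have "P \<inter> simplex_face c V t = P \<inter> (\<Inter>i\<in>t. simplex_facet c V i)"
    using Cons.prems(3) by (auto simp: simplex_face_def)
  also have "(\<Inter>i\<in>t. simplex_facet c V i) = \<Inter>(F ` S)"
    by (simp add: S_def facets)
  finally have face: "P \<inter> simplex_face c V t = label_face P F S" by (simp add: label_face_def)
  have "S \<in> nested V ?B \<and> nested V (insert t ?B) = stellar S t (nested V ?B) \<and> (t \<notin> ?B \<or> S = {t})"
  \<comment> \<open>A one-node tube already labels a facet, so cutting it off is the case
    \<open>S = {t}\<close> with unchanged complex.\<close>
  proof (cases "t \<in> D")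
    case True
    then obtain i where i: "t = {i}" by (auto simp: D_def)
    then have S1: "S = {t}" by (simp add: S_def)
    have "S \<in> nested V ?B"
    proof (rule nestedI)
      fix A assume "A \<subseteq> S" "\<Union>A \<in> ?B"
      moreover have "{} \<notin> ?B" using tube by (auto simp: D_def tube_def)
      ultimately show "\<Union>A \<in> A" by (auto simp: S1 subset_singleton_iff)
    qed (use S1 t True in auto)
    moreover have "stellar {t} t (nested V ?B) = nested V ?B"
      by (rule stellar_singleton, rule simple_labelling_downclosed[OF lab])
    moreover have "insert t ?B = ?B" using True by blast
    ultimately show ?thesis using S1 by simp
  next
    case False
    have tB: "t \<notin> ?B" using False t(3) by blast
    have BV: "?B \<subseteq> Pow V" using conn by blast
    have ne: "{} \<notin> ?B" using tube by (auto simp: D_def tube_def)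
    have SB: "(\<lambda>i. {i}) ` t \<subseteq> ?B" using S by (auto simp: S_def)
    \<comment> \<open>Tubes in \<open>E\<close> are at least as large as \<open>t\<close>, so one
      inside \<open>t\<close> would be \<open>t\<close>.\<close>
    have small: "\<exists>i. u = {i}" if u: "u \<in> ?B" "u \<subseteq> t" for u
    proof (cases "u \<in> E")
      case True
      then have "u = t" using tE card_seteq[OF t(4) u(2)] by blast
      then show ?thesis using True t(3) by simp
    qed (use u in \<open>auto simp: D_def\<close>)
    \<comment> \<open>A connected union short of \<open>V\<close> is a tube. If it were still to
      come, it would be no larger than \<open>t\<close>, forcing
      \<open>u \<subseteq> t\<close>.\<close>
    have un: "u \<subseteq> t \<or> u \<union> t = V \<or> u \<union> t \<in> ?B" if u: "u \<in> ?B" "u \<inter> t \<noteq> {}" for u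
    proof (rule ccontr)
      assume no: "\<not> ?thesis"
      have "gconn G (u \<union> t)" using connected_Un[OF conn(1)[OF u(1)] _ u(2)] tube[of t]
        by (simp add: tube_def)
      then have "u \<union> t \<in> tubes G"
        using no conn(2)[OF u(1)] t by (auto simp: tubes_def tube_def V_def)
      then have "u \<union> t \<in> set (t # ts)" using no Cons.prems(4) by blast
      then have "card (u \<union> t) \<le> card t" using Cons.prems(9) by auto
      moreover have "finite (u \<union> t)"
        using conn(2)[OF u(1)] fin t(4) by (auto intro: finite_subset)
      ultimately have "t = u \<union> t" using card_seteq[of "u \<union> t" t] by blast
      then show False using no by blast
    qed
    have "S \<in> nested V ?B"
      unfolding S_def by (rule nested_insert(1)[OF t(1,2) tB BV ne SB]) (fact small un)+
    moreover have "nested V (insert t ?B) = stellar S t (nested V ?B)"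
      unfolding S_def by (rule nested_insert(2)[OF t(1,2) tB BV ne SB]) (fact small un)+
    ultimately show ?thesis using tB by simp
  qed
  then have SK: "S \<in> nested V ?B" and K: "nested V (insert t ?B) = stellar S t (nested V ?B)"
    and new: "t \<notin> ?B \<or> S = {t}" by simp_all
  obtain F' where F': "simple_labelling Q (insert t ?B) (stellar S t (nested V ?B)) F'"
    "\<forall>i. i \<noteq> t \<longrightarrow> F' i = F i"
    using simple_labelling_truncation[OF lab SK S(1) new] Q(1) face by metis
  have ins: "insert t ?B = D \<union> insert t E" by blast
  show ?case
  proof (rule Cons.IH[OF Q(2)])
    show "simple_labelling Q (D \<union> insert t E) (nested V (D \<union> insert t E)) F'"
      using F'(1) unfolding K[symmetric] ins .
    show "Q \<subseteq> convex hull (c ` V)" using truncation_subset[OF Q(1)] Cons.prems(3) by blast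
    show "insert t E \<union> set ts = tubes G" using Cons.prems(4) by auto
    show "insert t E \<inter> set ts = {}" using Cons.prems(5,6) by auto
    show "distinct ts" using Cons.prems by simp
    show "F' {i} = simplex_facet c V i" if "i \<in> V" "{i} \<notin> insert t E" for i
      using F'(2) that Cons.prems(7) by auto
    show "card s \<le> card u" if "s \<in> set ts" "u \<in> insert t E" for s u
      using that Cons.prems(8,9) by auto
    show "sorted_wrt (\<lambda>u t. card t \<le> card u) ts" using Cons.prems by simp
  qed
qed

theorem theorem2p6:
  fixes G :: "('a, 'b) pre_digraph" and P :: "'c::euclidean_space set"
  assumes "sym_digraph G" and "finite (verts G)"
    and "graph_associahedron G P"
  shows "simple_polytope P \<and>
    poset_isomorphic (faces P) (\<subseteq>) {T. tubing G T} tubing_le"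
proof -
  let ?V = "verts G" and ?D = "(\<lambda>i. {i}) ` verts G"
  obtain c ts where c: "inj_on c ?V" "\<not> affine_dependent (c ` ?V)"
    and ts: "distinct ts" "set ts = tubes G"
      "sorted (map (\<lambda>t. aff_dim (simplex_face c ?V t)) ts)"
    and tr: "truncations (convex hull (c ` ?V)) (map (simplex_face c ?V) ts) P"
    using assms(3) unfolding graph_associahedron_def by blast
  have sub: "t \<subseteq> ?V" if "t \<in> set ts" for t using that ts(2) by (auto simp: tubes_def tube_def)
  have "sorted_wrt (\<lambda>u t. aff_dim (simplex_face c ?V u) \<le> aff_dim (simplex_face c ?V t)) ts"
    using ts(3) by (simp add: sorted_map)
  \<comment> \<open>The face of \<open>t\<close> has dimension \<open>card V - card t - 1\<close>,
    so increasing dimension means decreasing tube size.\<close>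
  then have sorted: "sorted_wrt (\<lambda>u t. card t \<le> card u) ts"
    by (rule sorted_wrt_mono_rel[rotated])
      (simp add: aff_dim_simplex_face[OF assms(2) c(2,1) sub])
  have "\<exists>F. simple_labelling P (?D \<union> tubes G) (nested ?V (?D \<union> tubes G)) F"
    by (rule truncations_simple_labelling[OF assms(1,2) tr, of "{}"
          "\<lambda>t. \<Inter>i\<in>t. simplex_facet c ?V i"])
      (use simple_labelling_simplex[OF assms(2) c(2,1)] ts sorted in auto)
  then obtain F where F: "simple_labelling P (?D \<union> tubes G) {T. tubing G T} F"
    unfolding sym_digraph.nested_eq_tubing[OF assms(1,2)] by blast
  show ?thesis
    unfolding tubing_le_def
    using simple_labelling_simple_polytope[OF F] simple_labelling_faces[OF F] by blast
qed

end
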